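(* Suppose (i) $\Pi_{N,E}\Rightarrow\Pi_E$ weakly; (ii) $T_E$ is (defined and) continuous on a neighborhood of $\operatorname{supp}(\Pi_E)$; and (iii) for every fixed $m$, $\int\|\mathbb Q_{N,\mu}(X_{1:m}\in\cdot)-T_E(\mu)^{\otimes m}\|_{\mathrm{TV}}\,\Pi_{N,E}(d\mu)\to0$. Let $\widetilde\Pi_E=(T_E)_\#\Pi_E$ and let $\widetilde{\mathbb P}_E=\int q^{\otimes\infty}\,\widetilde\Pi_E(dq)$ be the resulting infinite exchangeable law on $\mathcal X^{\mathbb N}$, with random directing measure $Q^\star\sim\widetilde\Pi_E$. Then, for fixed $t$, every history $x_{1:t}\in\mathcal X^t$ of positive $\widetilde{\mathbb P}_E$-marginal probability, and every $x\in\mathcal X$, $$\widetilde{\mathbb P}_E(X_{t+1}=x\mid X_{1:t}=x_{1:t})=\frac{\int P^\star_\mu(x)\prod_{j=1}^tP^\star_\mu(x_j)\,\Pi_E(d\mu)}{\int\prod_{j=1}^tP^\star_\mu(x_j)\,\Pi_E(d\mu)} .$$ This is the standard de Finetti posterior predictive under the prior $\widetilde\Pi_E$, i.e. it equals $\int q(x)\prod_{j\le t}q(x_j)\,\widetilde\Pi_E(dq)\big/\int\prod_{j\le t}q(x_j)\,\widetilde\Pi_E(dq)$. Moreover, as $t\to\infty$, $$\widetilde{\mathbb P}_E(X_{t+1}\in\cdot\mid X_{1:t})\longrightarrow Q^\star\qquad\text{almost surely},$$ where $Q^\star$ has law $\widetilde\Pi_E$.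
   Context: Let $\mathcal X=\{1,\dots,k\}$, $\Delta(\mathcal X)$ the probability simplex, $\|P-Q\|_{\mathrm{TV}}=\tfrac12\sum|P-Q|$, $D(Q\|\mu)=\sum_xQ(x)\log\{Q(x)/\mu(x)\}$ ($=+\infty$ if $Q\not\ll\mu$), $\langle g,Q\rangle=\sum_xg(x)Q(x)$. Given $g_1,\dots,g_r:\mathcal X\to\mathbb R$, $\alpha_j\in\mathbb R$, $0\le r_0\le r$, let $$E=\{Q\in\Delta(\mathcal X):\langle g_j,Q\rangle=\alpha_j\ (j\le r_0),\ \langle g_j,Q\rangle\ge\alpha_j\ (r_0<j\le r)\}\ne\varnothing,$$ $$E_\varepsilon=\{Q\in\Delta(\mathcal X):|\langle g_j,Q\rangle-\alpha_j|\le\varepsilon\ (j\le r_0),\ \langle g_j,Q\rangle\ge\alpha_j-\varepsilon\ (r_0<j\le r)\},$$ and let $\varepsilon_N>0$, $\varepsilon_N\to0$. Let $\Pi$ be a probability measure on $\Delta(\mathcal X)$. Under $\mathbb P_\mu$, $X_1,\dots,X_N$ are i.i.d. $\mu$; $\widehat P_N=\frac1N\sum_{i\le N}\delta_{X_i}$, $E_N=\{\widehat P_N\in E_{\varepsilon_N}\}$; $\int\mathbb P_\nu(E_N)\Pi(d\nu)>0$ is assumed. The constraint posterior is $\Pi_{N,E}(d\mu)=\mathbb P_\mu(E_N)\Pi(d\mu)/\int\mathbb P_\nu(E_N)\Pi(d\nu)$, and $\mathbb Q_{N,\mu}(\cdot)=\mathbb P_\mu(\cdot\mid E_N)$. The projection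 map is $T_E(\mu)=P^\star_\mu=\arg\min_{Q\in E}D(Q\|\mu)$, defined (the minimizer being unique) wherever the minimum is finite; it is assumed defined for $\Pi_{N,E}$-a.e. $\mu$. The directing measure $Q^\star$ of $\widetilde{\mathbb P}_E$ is the random measure conditionally on which $(X_i)_{i\ge1}$ is i.i.d. $Q^\star$. *)

theory Defs
  imports "HOL-Probability.Probability"
begin

text \<open>
  The alphabet is an arbitrary nonempty finite type \<open>'k\<close>; a distribution on it is its vector of
  point masses in \<open>real ^ 'k\<close>.
\<close>

definition prob_simplex :: "(real ^ 'k::finite) set" where
  "prob_simplex = {q. (\<forall>x. 0 \<le> q $ x) \<and> (\<Sum>x\<in>UNIV. q $ x) = 1}"

abbreviation simplex_borel :: "(real ^ 'k::finite) measure" where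
  "simplex_borel \<equiv> restrict_space borel prob_simplex"

definition mean :: "('k::finite \<Rightarrow> real) \<Rightarrow> real ^ 'k \<Rightarrow> real" where
  "mean g q = (\<Sum>x\<in>UNIV. g x * q $ x)"

text \<open>Constraints \<open>1, \<dots>, r0\<close> are equalities, constraints \<open>r0 + 1, \<dots>, r\<close> are inequalities.\<close>

definition constraint_set ::
  "(nat \<Rightarrow> 'k::finite \<Rightarrow> real) \<Rightarrow> (nat \<Rightarrow> real) \<Rightarrow> nat \<Rightarrow> nat \<Rightarrow> (real ^ 'k) set" where
  "constraint_set g \<alpha> r0 r =
     {q \<in> prob_simplex. (\<forall>j\<in>{1..r0}. mean (g j) q = \<alpha> j) \<and> (\<forall>j\<in>{r0<..r}. mean (g j) q \<ge> \<alpha> j)}"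

definition relaxed_set ::
  "(nat \<Rightarrow> 'k::finite \<Rightarrow> real) \<Rightarrow> (nat \<Rightarrow> real) \<Rightarrow> nat \<Rightarrow> nat \<Rightarrow> real \<Rightarrow> (real ^ 'k) set" where
  "relaxed_set g \<alpha> r0 r \<epsilon> =
     {q \<in> prob_simplex. (\<forall>j\<in>{1..r0}. \<bar>mean (g j) q - \<alpha> j\<bar> \<le> \<epsilon>) \<and>
                   (\<forall>j\<in>{r0<..r}. mean (g j) q \<ge> \<alpha> j - \<epsilon>)}"

text \<open>
  The convention \<open>0 log 0 = 0\<close> is built in, as the factor \<open>q $ x\<close> vanishes and
  \<open>ln\<close> and division are total.
\<close>

definition rel_entropy :: "real ^ 'k::finite \<Rightarrow> real ^ 'k \<Rightarrow> ereal" where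
  "rel_entropy q \<mu> =
     (if \<exists>x. \<mu> $ x = 0 \<and> q $ x \<noteq> 0 then \<infinity>
      else ereal (\<Sum>x\<in>UNIV. q $ x * ln (q $ x / \<mu> $ x)))"

text \<open>
  \<open>info_proj E\<close> is total; it is the projection map only on \<open>info_proj_dom E\<close>, the set on which the minimum
  exists and is finite. Elsewhere its value is an unspecified point of \<open>E\<close>.
\<close>

definition info_proj_dom :: "(real ^ 'k::finite) set \<Rightarrow> (real ^ 'k) set" where
  "info_proj_dom E =
     {\<mu> \<in> prob_simplex. \<exists>q. is_arg_min (\<lambda>q. rel_entropy q \<mu>) (\<lambda>q. q \<in> E) q \<and> rel_entropy q \<mu> < \<infinity>}"

definition info_proj :: "(real ^ 'k::finite) set \<Rightarrow> real ^ 'k \<Rightarrow> real ^ 'k" where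
  "info_proj E \<mu> = arg_min_on (\<lambda>q. rel_entropy q \<mu>) E"

definition letter_law :: "real ^ 'k::finite \<Rightarrow> 'k measure" where
  "letter_law q = point_measure UNIV (\<lambda>x. ennreal (q $ x))"

text \<open>
  Sample paths are indexed from \<open>0\<close>: the coordinate \<open>\<omega> i\<close> is the observation \<open>X\<^sub>i\<^sub>+\<^sub>1\<close>, so that
  \<open>X\<^sub>1, \<dots>, X\<^sub>t\<close> are the coordinates below \<open>t\<close> and \<open>X\<^sub>t\<^sub>+\<^sub>1\<close> is \<open>\<omega> t\<close>.
\<close>

abbreviation path_space :: "(nat \<Rightarrow> 'k::finite) measure" where
  "path_space \<equiv> (\<Pi>\<^sub>M i\<in>UNIV. count_space UNIV)"

definition iid_law :: "real ^ 'k::finite \<Rightarrow> (nat \<Rightarrow> 'k) measure" where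
  "iid_law q = (\<Pi>\<^sub>M i\<in>UNIV. letter_law q)"

definition empirical :: "nat \<Rightarrow> (nat \<Rightarrow> 'k::finite) \<Rightarrow> real ^ 'k" where
  "empirical N \<omega> = (1 / real N) *\<^sub>R (\<Sum>i<N. axis (\<omega> i) 1)"

definition prefix_law :: "nat \<Rightarrow> (nat \<Rightarrow> 'k::finite) measure \<Rightarrow> (nat \<Rightarrow> 'k) measure" where
  "prefix_law m M = distr M (\<Pi>\<^sub>M i\<in>{..<m}. count_space UNIV) (\<lambda>\<omega>. restrict \<omega> {..<m})"

definition product_law :: "nat \<Rightarrow> real ^ 'k::finite \<Rightarrow> (nat \<Rightarrow> 'k) measure" where
  "product_law m q = (\<Pi>\<^sub>M i\<in>{..<m}. letter_law q)"

text \<open>Total variation distance of two laws on a common finite space.\<close>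

definition tv_dist :: "'a measure \<Rightarrow> 'a measure \<Rightarrow> real" where
  "tv_dist M N = (\<Sum>x\<in>space M. \<bar>measure M {x} - measure N {x}\<bar>) / 2"

definition constraint_posterior ::
  "(real ^ 'k::finite) measure \<Rightarrow> (nat \<Rightarrow> 'k) set \<Rightarrow> (real ^ 'k) measure" where
  "constraint_posterior prior A =
     density prior (\<lambda>\<mu>. ennreal (measure (iid_law \<mu>) A / (\<integral>\<nu>. measure (iid_law \<nu>) A \<partial>prior)))"

definition weakly_converges ::
  "(nat \<Rightarrow> 'a::topological_space measure) \<Rightarrow> 'a measure \<Rightarrow> bool" where
  "weakly_converges M L \<longleftrightarrow>
     (\<forall>f :: 'a \<Rightarrow> real. continuous_on (space L) f \<and> bounded (f ` space L) \<longrightarrow>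
        (\<lambda>N. \<integral>x. f x \<partial>M N) \<longlonglongrightarrow> (\<integral>x. f x \<partial>L))"

definition msupport :: "'a::topological_space measure \<Rightarrow> 'a set" where
  "msupport M = {x \<in> space M. \<forall>U. open U \<and> x \<in> U \<longrightarrow> emeasure M (U \<inter> space M) > 0}"

text \<open>
  \<open>Q\<close> is a directing measure of the process \<open>X\<close> on the probability space \<open>M\<close>: given the
  sigma-algebra generated by \<open>Q\<close>, the process is i.i.d. with law \<open>Q\<close>.
\<close>

definition directing_measure ::
  "'w measure \<Rightarrow> ('w \<Rightarrow> nat \<Rightarrow> 'k::finite) \<Rightarrow> ('w \<Rightarrow> real ^ 'k) \<Rightarrow> bool" where
  "directing_measure M X Q \<longleftrightarrow>
     X \<in> measurable M path_space \<and> Q \<in> measurable M simplex_borel \<and>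
     (\<forall>A\<in>sets path_space. AE w in M.
        real_cond_exp M (vimage_algebra (space M) Q simplex_borel)
          (indicator (X -` A \<inter> space M)) w = measure (iid_law (Q w)) A)"

text \<open>The conditional law of \<open>X\<^sub>t\<^sub>+\<^sub>1\<close> given that \<open>X\<^sub>1, \<dots>, X\<^sub>t\<close> equals \<open>h 0, \<dots>, h (t - 1)\<close>.\<close>

definition predictive ::
  "(nat \<Rightarrow> 'k::finite) measure \<Rightarrow> nat \<Rightarrow> (nat \<Rightarrow> 'k) \<Rightarrow> real ^ 'k" where
  "predictive M t h = (\<chi> x. cond_prob M (\<lambda>\<omega>. \<omega> t = x) (\<lambda>\<omega>. \<forall>j<t. \<omega> j = h j))"

end

theory Submission
  imports Defs "HOL-Real_Asymp.Real_Asymp"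
begin

text \<open>
  Letter frequencies recover the parameter: by Hoeffding's inequality and Borel--Cantelli they converge
  to \<open>q\<close> almost surely under the i.i.d. law of \<open>q\<close>. Under a mixture of i.i.d. laws the limiting frequency
  therefore has the mixing law and is a directing measure, and every directing measure agrees with it
  almost surely. The predictive probability of \<open>x\<close> is the average of the limiting frequency of \<open>x\<close>
  over the cylinder of the observed history; it converges by a maximal inequality for cylinder averages,
  as in martingale convergence, because the limiting frequency is an \<open>L\<^sup>1\<close> limit of functions of
  finitely many letters.

  The mixing law is an image measure, which is junk unless the information projection is measurable on
  the whole simplex. On each open face of the simplex it is either constant (no point of \<open>E\<close> is supported
  on the face) or continuous, as the unique minimizer over a compact set.
\<close>

subsection \<open>I.i.d. laws and limiting frequencies\<close>

lemma space_simplex_borel [simp]: "space simplex_borel = prob_simplex"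
  by (simp add: space_restrict_space)

lemma closed_prob_simplex: "closed (prob_simplex :: (real ^ 'k::finite) set)"
proof -
  have "prob_simplex = (\<Inter>x. {q :: real ^ 'k. 0 \<le> q $ x}) \<inter> {q. (\<Sum>x\<in>UNIV. q $ x) = 1}"
    by (auto simp: prob_simplex_def)
  also have "closed \<dots>"
    by (intro closed_Int closed_INT ballI closed_Collect_le closed_Collect_eq continuous_intros)
  finally show ?thesis .
qed

lemma prob_simplex_nonneg: "q \<in> prob_simplex \<Longrightarrow> 0 \<le> q $ x"
  by (simp add: prob_simplex_def)

lemma prob_simplex_le_1: "q \<in> prob_simplex \<Longrightarrow> q $ x \<le> 1"
  using member_le_sum[of x UNIV "($) q"] by (simp add: prob_simplex_def)

lemma measurable_vec_nth_simplex [measurable]: "(\<lambda>q. q $ x) \<in> borel_measurable simplex_borel"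
  by (intro measurable_restrict_space1) simp

lemma sets_letter_law [measurable_cong, simp]: "sets (letter_law q) = UNIV"
  by (simp add: letter_law_def sets_point_measure)

lemma space_letter_law [simp]: "space (letter_law q) = UNIV"
  by (simp add: letter_law_def space_point_measure)

lemma measurable_letter_law_iff [simp]: "f \<in> letter_law q \<rightarrow>\<^sub>M N \<longleftrightarrow> f \<in> UNIV \<rightarrow> space N"
  by (auto simp: measurable_def)

lemma emeasure_letter_law:
  "q \<in> prob_simplex \<Longrightarrow> emeasure (letter_law q) A = ennreal (\<Sum>x\<in>A. q $ x)"
  by (simp add: letter_law_def emeasure_point_measure_finite2 prob_simplex_def sum_ennreal)

lemma prob_space_letter_law: "q \<in> prob_simplex \<Longrightarrow> prob_space (letter_law q)"
  by (rule prob_spaceI) (simp add: emeasure_letter_law, simp add: prob_simplex_def)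

section \<open>Path laws as a probability kernel\<close>

lemma sets_iid_law [measurable_cong, simp]: "sets (iid_law q) = sets path_space"
  unfolding iid_law_def by (intro sets_PiM_cong) simp_all

lemma space_path_space [simp]: "space path_space = UNIV"
  by (simp add: space_PiM)

lemma space_iid_law [simp]: "space (iid_law q) = UNIV"
  using sets_eq_imp_space_eq[OF sets_iid_law] by (simp add: space_PiM)

lemma prob_space_iid_law: "q \<in> prob_simplex \<Longrightarrow> prob_space (iid_law q)"
  unfolding iid_law_def by (intro prob_space_PiM prob_space_letter_law)

lemma measure_iid_law_UNIV: "q \<in> prob_simplex \<Longrightarrow> measure (iid_law q) UNIV = 1"
  using prob_space.prob_space[OF prob_space_iid_law] by simp

lemma UNIV_in_sets_path_space: "UNIV \<in> sets path_space"
  using sets.top[of path_space] by simp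

lemma sets_path_space_Collect:
  "Measurable.pred path_space P \<Longrightarrow> {\<omega>. P \<omega>} \<in> sets path_space"
  by (simp add: pred_def)

lemma emeasure_iid_law_cylinder:
  assumes "q \<in> prob_simplex" "finite J"
  shows "emeasure (iid_law q) {\<omega>. \<forall>j\<in>J. \<omega> j \<in> A j} = (\<Prod>j\<in>J. emeasure (letter_law q) (A j))"
proof -
  have "{\<omega>. \<forall>j\<in>J. \<omega> j \<in> A j} = prod_emb UNIV (\<lambda>_. letter_law q) J (Pi\<^sub>E J A)"
    by (auto simp: prod_emb_def)
  then show ?thesis
    unfolding iid_law_def
    using emeasure_PiM_emb[of UNIV "\<lambda>_. letter_law q" J A] assms
    by (simp add: prob_space_letter_law)
qed

lemma measure_iid_law_history:
  assumes "q \<in> prob_simplex"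
  shows "measure (iid_law q) {\<omega>. \<forall>j<t. \<omega> j = h j} = (\<Prod>j<t. q $ h j)"
proof -
  have "emeasure (iid_law q) {\<omega>. \<forall>j<t. \<omega> j = h j} = (\<Prod>j<t. ennreal (q $ h j))"
    using emeasure_iid_law_cylinder[OF assms, of "{..<t}" "\<lambda>j. {h j}"] assms
    by (simp add: emeasure_letter_law Ball_def lessThan_def)
  also have "\<dots> = ennreal (\<Prod>j<t. q $ h j)"
    using assms by (intro prod_ennreal) (auto simp: prob_simplex_def)
  finally show ?thesis
    using assms by (simp add: measure_def prob_simplex_def prod_nonneg)
qed

text \<open>Finite-dimensional cylinders form an intersection-stable generator, and on them the
  probability is a finite product of finite sums of coordinates of the parameter. This makes
  \<open>iid_law\<close> a kernel, as \<open>bind\<close> requires.\<close>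

lemma measurable_iid_law [measurable]:
  "iid_law \<in> simplex_borel \<rightarrow>\<^sub>M subprob_algebra (path_space :: (nat \<Rightarrow> 'k::finite) measure)"
proof (rule measurable_subprob_algebra_generated)
  let ?G = "prod_algebra UNIV (\<lambda>_::nat. count_space (UNIV :: 'k set))"
  show "sets path_space = sigma_sets (\<Pi>\<^sub>E i\<in>UNIV. space (count_space (UNIV :: 'k set))) ?G"
    by (rule sets_PiM)
  show "Int_stable ?G" by (rule Int_stable_prod_algebra)
  show "?G \<subseteq> Pow (\<Pi>\<^sub>E i\<in>UNIV. space (count_space (UNIV :: 'k set)))"
    by (rule prod_algebra_sets_into_space)
  fix a :: "real ^ 'k" assume "a \<in> space simplex_borel"
  then show "subprob_space (iid_law a)"
    by (intro prob_space_imp_subprob_space prob_space_iid_law) simp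
  show "sets (iid_law a) = sets path_space" by simp
next
  have *: "(\<lambda>a :: real ^ 'k. emeasure (iid_law a) {\<omega>. \<forall>j\<in>J. \<omega> j \<in> A j}) \<in> borel_measurable simplex_borel"
    if "finite J" for J :: "nat set" and A
  proof (subst measurable_cong[where g = "\<lambda>a. \<Prod>j\<in>J. ennreal (\<Sum>x\<in>A j. a $ x)"])
    show "(\<lambda>a :: real ^ 'k. \<Prod>j\<in>J. ennreal (\<Sum>x\<in>A j. a $ x)) \<in> borel_measurable simplex_borel"
      by measurable
  qed (simp add: emeasure_iid_law_cylinder that emeasure_letter_law)
  show "(\<lambda>a. emeasure (iid_law a) X) \<in> borel_measurable simplex_borel"
    if X_in: "X \<in> prod_algebra UNIV (\<lambda>_::nat. count_space (UNIV :: 'k set))" for X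
  proof -
    obtain J A where J: "finite J" and X: "X = prod_emb UNIV (\<lambda>_. count_space UNIV) J (Pi\<^sub>E J A)"
      using X_in by (rule prod_algebraE)
    have "X = {\<omega>. \<forall>j\<in>J. \<omega> j \<in> A j}"
      by (auto simp: X prod_emb_def)
    with *[OF J] show ?thesis by simp
  qed
  show "(\<lambda>a. emeasure (iid_law a) (\<Pi>\<^sub>E i\<in>UNIV. space (count_space (UNIV :: 'k set)))) \<in> borel_measurable simplex_borel"
    using *[of "{}"] by simp
qed

section \<open>Strong law of large numbers for letter frequencies\<close>

lemma distr_iid_law_component:
  "q \<in> prob_simplex \<Longrightarrow> distr (iid_law q) (letter_law q) (\<lambda>\<omega>. \<omega> i) = letter_law q"
  unfolding iid_law_def by (intro distr_PiM_component prob_space_letter_law) auto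

lemma empirical_nth: "empirical N \<omega> $ x = (\<Sum>i<N. indicator {x} (\<omega> i)) / real N"
proof -
  have "axis (\<omega> i) 1 $ x = (indicator {x} (\<omega> i) :: real)" for i
    by (auto simp: axis_def indicator_def)
  then show ?thesis by (simp add: empirical_def)
qed

lemma measurable_empirical_nth [measurable]:
  "(\<lambda>\<omega>. empirical N \<omega> $ x) \<in> borel_measurable path_space"
  unfolding empirical_nth by measurable

lemma borel_measurableI_vec:
  fixes f :: "'a \<Rightarrow> real ^ 'k::finite"
  assumes "\<And>x. (\<lambda>w. f w $ x) \<in> borel_measurable M"
  shows "f \<in> borel_measurable M"
  unfolding borel_measurable_euclidean_space[where f = f]
  using assms by (auto simp: Basis_vec_def inner_axis)

lemma measurable_empirical [measurable]: "empirical N \<in> borel_measurable path_space"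
  by (rule borel_measurableI_vec) simp

lemma empirical_nth_bounds: "0 \<le> empirical N \<omega> $ x" "empirical N \<omega> $ x \<le> 1"
proof -
  have "(\<Sum>i<N. indicator {x} (\<omega> i) :: real) \<le> (\<Sum>i<N. 1)"
    by (intro sum_mono) (auto simp: indicator_def)
  then show "empirical N \<omega> $ x \<le> 1"
    by (simp add: empirical_nth divide_le_eq)
qed (simp add: empirical_nth sum_nonneg)

text \<open>The coordinates together are the identity map on paths, so their joint law is the
  product measure itself, and independence means that the joint law is the product of the
  marginals.\<close>

lemma indep_vars_iid_law:
  assumes "q \<in> prob_simplex"
  shows "prob_space.indep_vars (iid_law q) (\<lambda>_. letter_law q) (\<lambda>i \<omega>. \<omega> i) UNIV"
proof -
  interpret prob_space "iid_law q" by (rule prob_space_iid_law) fact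
  have "distr (iid_law q) (\<Pi>\<^sub>M i\<in>UNIV. letter_law q) (\<lambda>\<omega>. \<lambda>i\<in>UNIV. \<omega> i) = iid_law q"
    unfolding iid_law_def by (simp add: restrict_UNIV distr_id)
  also have "\<dots> = (\<Pi>\<^sub>M i\<in>UNIV. distr (iid_law q) (letter_law q) (\<lambda>\<omega>. \<omega> i))"
    using assms by (simp add: distr_iid_law_component) (simp add: iid_law_def)
  finally show ?thesis
    by (subst indep_vars_iff_distr_eq_PiM) (auto simp: iid_law_def)
qed

text \<open>Hoeffding's inequality for \<open>N\<close> indicators with values between 0 and 1: a
  deviation \<open>\<epsilon> * N\<close> of their sum gives the exponent
  \<open>- 2 * (\<epsilon> * N)^2 / N\<close>.\<close>

lemma iid_law_empirical_deviation:
  assumes q: "q \<in> prob_simplex" and "N > 0" "\<epsilon> \<ge> 0"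
  shows "measure (iid_law q) {\<omega>. \<bar>empirical N \<omega> $ x - q $ x\<bar> \<ge> \<epsilon>} \<le> 2 * exp (- 2 * real N * \<epsilon>\<^sup>2)"
proof -
  interpret prob_space "iid_law q" by (rule prob_space_iid_law) fact
  let ?X = "\<lambda>i \<omega>. indicator {x} (\<omega> i) :: real"
  have expect: "expectation (?X i) = q $ x" for i
  proof -
    have "expectation (?X i) = (\<integral>y. indicator {x} y \<partial>distr (iid_law q) (letter_law q) (\<lambda>\<omega>. \<omega> i))"
      by (rule integral_distr[symmetric]) (auto simp: iid_law_def)
    also have "\<dots> = q $ x"
      using q unfolding distr_iid_law_component[OF q]
      by (simp add: measure_def emeasure_letter_law prob_simplex_def)
    finally show ?thesis .
  qed
  interpret Hoeffding_ineq "iid_law q" "{..<N}" ?X "\<lambda>_. 0" "\<lambda>_. 1" "real N * q $ x"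
  proof unfold_locales
    have "indep_vars (\<lambda>_. borel) ?X UNIV"
      by (rule indep_vars_compose2[OF indep_vars_iid_law[OF q]]) auto
    then show "indep_vars (\<lambda>_. borel) ?X {..<N}"
      by (rule indep_vars_subset) auto
  qed (auto simp: expect intro!: AE_I2 split: split_indicator)
  have "{\<omega>. \<bar>empirical N \<omega> $ x - q $ x\<bar> \<ge> \<epsilon>} =
      {\<omega> \<in> space (iid_law q). \<bar>(\<Sum>i<N. ?X i \<omega>) - real N * q $ x\<bar> \<ge> \<epsilon> * real N}"
  proof -
    have "\<bar>s / real N - c\<bar> = \<bar>s - real N * c\<bar> / real N" for s c :: real
      using \<open>N > 0\<close> by (simp add: field_simps abs_divide)
    then show ?thesis
      using \<open>N > 0\<close> by (simp add: empirical_nth le_divide_eq)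
  qed
  then show ?thesis
    using Hoeffding_ineq_abs_ge[of "\<epsilon> * real N"] assms by (simp add: power2_eq_square mult_ac)
qed

text \<open>The Hoeffding tails are geometric in \<open>N\<close>, hence summable, so Borel-Cantelli
  applies for each letter and each tolerance \<open>1 / Suc k\<close>; there are countably many such
  pairs.\<close>

lemma AE_iid_law_empirical_tendsto:
  assumes q: "q \<in> prob_simplex"
  shows "AE \<omega> in iid_law q. (\<lambda>N. empirical N \<omega>) \<longlonglongrightarrow> q"
proof -
  interpret prob_space "iid_law q" by (rule prob_space_iid_law) fact
  have ev: "AE \<omega> in iid_law q. \<forall>\<^sub>F N in sequentially. \<bar>empirical N \<omega> $ x - q $ x\<bar> < 1 / Suc k" for x k
  proof -
    let ?A = "\<lambda>N. {\<omega>. \<bar>empirical N \<omega> $ x - q $ x\<bar> \<ge> 1 / Suc k}"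
    have meas: "?A N \<in> sets (iid_law q)" for N
      unfolding sets_iid_law by (rule sets_path_space_Collect) measurable
    let ?c = "2 * (1 / Suc k)\<^sup>2"
    have "summable (\<lambda>N. measure (iid_law q) (?A N))"
    proof (rule summable_comparison_test')
      have "summable (\<lambda>N. exp (- ?c) ^ N)"
        by (rule summable_geometric) simp
      then show "summable (\<lambda>N. 2 * exp (- ?c) ^ N)"
        by (rule summable_mult)
      fix N :: nat assume "1 \<le> N"
      then have "measure (iid_law q) (?A N) \<le> 2 * exp (- 2 * real N * (1 / Suc k)\<^sup>2)"
        by (intro iid_law_empirical_deviation q) auto
      then show "norm (measure (iid_law q) (?A N)) \<le> 2 * exp (- ?c) ^ N"
        by (simp add: exp_of_nat_mult[symmetric] mult_ac)
    qed
    from borel_cantelli_AE1[OF meas _ this] show ?thesis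
      by (simp add: not_le emeasure_eq_measure)
  qed
  have "AE \<omega> in iid_law q. \<forall>x. \<forall>k. \<forall>\<^sub>F N in sequentially. \<bar>empirical N \<omega> $ x - q $ x\<bar> < 1 / Suc k"
    by (simp only: AE_all_countable AE_finite_all) (simp add: ev AE_all_countable del: of_nat_Suc)
  then show ?thesis
  proof (rule AE_mp, intro AE_I2 impI)
    fix \<omega> assume *: "\<forall>x k. \<forall>\<^sub>F N in sequentially. \<bar>empirical N \<omega> $ x - q $ x\<bar> < 1 / Suc k"
    show "(\<lambda>N. empirical N \<omega>) \<longlonglongrightarrow> q"
    proof (intro vec_tendstoI tendstoI)
      fix x and e :: real assume "e > 0"
      then obtain k where "1 / Suc k < e" using nat_approx_posE by blast
      then show "\<forall>\<^sub>F N in sequentially. dist (empirical N \<omega> $ x) (q $ x) < e"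
        using *[rule_format, of x k] by (elim eventually_mono) (simp add: dist_real_def)
    qed
  qed
qed

text \<open>Off the convergence set the value is a fixed simplex point, so that \<open>limit_freq\<close> is measurable.\<close>

definition limit_freq :: "(nat \<Rightarrow> 'k::finite) \<Rightarrow> real ^ 'k" where
  "limit_freq \<omega> =
     (if convergent (\<lambda>N. empirical N \<omega>) \<and> lim (\<lambda>N. empirical N \<omega>) \<in> prob_simplex
      then lim (\<lambda>N. empirical N \<omega>) else axis undefined 1)"

lemma axis_in_prob_simplex: "axis x 1 \<in> prob_simplex"
  by (auto simp: prob_simplex_def axis_def)

lemma limit_freq_in_prob_simplex: "limit_freq \<omega> \<in> prob_simplex"
  by (simp add: limit_freq_def axis_in_prob_simplex)

lemma limit_freq_eqI: 
  "(\<lambda>N. empirical N \<omega>) \<longlonglongrightarrow> q \<Longrightarrow> q \<in> prob_simplex \<Longrightarrow> limit_freq \<omega> = q"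
  by (auto simp: limit_freq_def convergent_def dest: limI)

text \<open>Convergence is the Cauchy property, a measurable condition, and the simplex is closed,
  so the case distinction in the definition is measurable.\<close>

lemma measurable_limit_freq [measurable]: "limit_freq \<in> path_space \<rightarrow>\<^sub>M simplex_borel"
proof (rule measurable_restrict_space2)
  have [measurable]: "prob_simplex \<in> sets borel"
    using closed_prob_simplex by (rule borel_closed)
  have [measurable]: "(\<lambda>\<omega>. lim (\<lambda>N. empirical N \<omega>)) \<in> borel_measurable path_space"
    by (rule borel_measurable_lim_metric) measurable
  have [measurable]: "Measurable.pred path_space (\<lambda>\<omega>. convergent (\<lambda>N. empirical N \<omega>))"
    unfolding Cauchy_convergent_iff[symmetric] pred_def by (rule sets_Collect_Cauchy) measurable
  show "limit_freq \<in> borel_measurable path_space"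
    unfolding limit_freq_def by measurable
qed (simp add: limit_freq_in_prob_simplex)

lemma AE_iid_law_limit_freq:
  "q \<in> prob_simplex \<Longrightarrow> AE \<omega> in iid_law q. limit_freq \<omega> = q"
  by (rule AE_mp[OF AE_iid_law_empirical_tendsto]) (auto intro: limit_freq_eqI)

subsection \<open>Mixtures and predictive probabilities\<close>

abbreviation (input) cylinder :: "nat \<Rightarrow> (nat \<Rightarrow> 'k) \<Rightarrow> (nat \<Rightarrow> 'k) set" where
  "cylinder t h \<equiv> {\<omega>. \<forall>j<t. \<omega> j = h j}"

lemma cylinder_in_sets [measurable, simp]: "cylinder t h \<in> sets path_space"
  by (rule sets_path_space_Collect) measurable

lemma cylinder_eq_iff: "cylinder t h = cylinder t h' \<longleftrightarrow> (\<forall>j<t. h j = h' j)"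
  by auto

lemma finite_range_cylinder: "finite (range (cylinder t :: (nat \<Rightarrow> 'k::finite) \<Rightarrow> _))"
proof (rule finite_subset)
  show "range (cylinder t) \<subseteq> cylinder t ` ({..<t} \<rightarrow>\<^sub>E (UNIV :: 'k set))"
  proof (rule image_subsetI)
    fix h :: "nat \<Rightarrow> 'k"
    have "cylinder t h = cylinder t (restrict h {..<t})"
      unfolding cylinder_eq_iff by simp
    then show "cylinder t h \<in> cylinder t ` ({..<t} \<rightarrow>\<^sub>E UNIV)"
      by (rule image_eqI[where f = "cylinder t" and x = "restrict h {..<t}"]) simp
  qed
  show "finite (cylinder t ` ({..<t} \<rightarrow>\<^sub>E (UNIV :: 'k set)))"
    by (intro finite_imageI finite_PiE) auto
qed

text \<open>Cylinders of the same length are equal or disjoint, so only the summand of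
  \<open>cylinder t \<xi>\<close> can be nonzero; the hypothesis makes \<open>B\<close> a union of
  such cylinders.\<close>

lemma indicator_eq_sum_cylinders:
  fixes B :: "(nat \<Rightarrow> 'k::finite) set"
  assumes B: "\<And>\<omega> \<xi>. \<omega> \<in> B \<Longrightarrow> \<xi> \<in> cylinder t \<omega> \<Longrightarrow> \<xi> \<in> B"
  shows "indicator B \<xi> = (\<Sum>H\<in>cylinder t ` B. indicator H \<xi> :: real)"
proof -
  have fin: "finite (cylinder t ` B)"
    by (rule finite_subset[OF _ finite_range_cylinder]) auto
  have eq: "\<xi> \<in> H \<longleftrightarrow> H = cylinder t \<xi>" if "H \<in> cylinder t ` B" for H
    using that by (auto simp: cylinder_eq_iff)
  have "cylinder t \<xi> \<in> cylinder t ` B \<longleftrightarrow> \<xi> \<in> B"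
    using B by (force simp: cylinder_eq_iff)
  moreover have "(\<Sum>H\<in>cylinder t ` B. indicator H \<xi> :: real) =
      (\<Sum>H\<in>cylinder t ` B. if H = cylinder t \<xi> then 1 else 0)"
    by (intro sum.cong refl) (auto simp: eq indicator_def)
  ultimately show ?thesis
    using fin by (simp add: indicator_def)
qed

lemma cylinder_closed_in_sets:
  fixes B :: "(nat \<Rightarrow> 'k::finite) set"
  assumes B: "\<And>\<omega> \<xi>. \<omega> \<in> B \<Longrightarrow> \<xi> \<in> cylinder t \<omega> \<Longrightarrow> \<xi> \<in> B"
  shows "B \<in> sets path_space"
proof -
  have "B = \<Union>(cylinder t ` B)"
    using B by auto
  also have "\<dots> \<in> sets path_space"
    by (intro sets.finite_Union finite_subset[OF _ finite_range_cylinder]) auto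
  finally show ?thesis .
qed

text \<open>Doob's maximal inequality for the martingale of cylinder averages of \<open>f\<close>: decompose at the first
  time at which the average reaches \<open>c\<close>.\<close>

lemma cylinder_maximal_inequality:
  fixes P :: "(nat \<Rightarrow> 'k::finite) measure"
  assumes P: "prob_space P" and sets_P [measurable_cong]: "sets P = sets path_space"
    and f: "integrable P f" "\<And>\<omega>. 0 \<le> f \<omega>" and c: "c > 0"
  defines "hit \<equiv> \<lambda>t \<omega>. c * measure P (cylinder t \<omega>) \<le> (\<integral>\<xi>. indicator (cylinder t \<omega>) \<xi> * f \<xi> \<partial>P)"
  shows "{\<omega>. \<exists>t. hit t \<omega>} \<in> sets P" "measure P {\<omega>. \<exists>t. hit t \<omega>} \<le> (\<integral>\<xi>. f \<xi> \<partial>P) / c"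
proof -
  interpret prob_space P by fact
  have space_P [simp]: "space P = UNIV"
    using sets_eq_imp_space_eq[OF sets_P] by simp
  have integrable_indicator_mult: "integrable P (\<lambda>\<xi>. indicator A \<xi> * f \<xi>)" if "A \<in> sets path_space" for A
    using integrable_mult_indicator[of A P f] that f(1) by (simp add: sets_P)
  define B where "B t = {\<omega>. hit t \<omega> \<and> (\<forall>s<t. \<not> hit s \<omega>)}" for t
  \<comment> \<open>The averages up to time \<open>t\<close> depend only on the first
    \<open>t\<close> letters, so the first-passage event \<open>B t\<close> is a union of cylinders
    of length \<open>t\<close>: the stopping-time property.\<close>
  have B_closed: "\<xi> \<in> B t" if "\<omega> \<in> B t" "\<xi> \<in> cylinder t \<omega>" for \<omega> \<xi> t
  proof -
    have "cylinder s \<xi> = cylinder s \<omega>" if "s \<le> t" for s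
      unfolding cylinder_eq_iff using \<open>\<xi> \<in> cylinder t \<omega>\<close> that by auto
    then have "hit s \<xi> = hit s \<omega>" if "s \<le> t" for s
      using that by (simp add: hit_def)
    then show ?thesis
      using \<open>\<omega> \<in> B t\<close> by (auto simp: B_def)
  qed
  have B_sets [measurable]: "B t \<in> sets path_space" for t
    using cylinder_closed_in_sets B_closed by blast
  have B_le: "c * measure P (B t) \<le> (\<integral>\<xi>. indicator (B t) \<xi> * f \<xi> \<partial>P)" for t
  proof -
    let ?H = "cylinder t ` B t"
    have ind: "indicator (B t) \<xi> = (\<Sum>H\<in>?H. indicator H \<xi> :: real)" for \<xi>
      using indicator_eq_sum_cylinders[of "B t" t \<xi>] B_closed by blast
    have H_sets: "H \<in> sets P" if "H \<in> ?H" for H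
      using that by (auto simp: sets_P)
    have "c * measure P (B t) = c * (\<integral>\<xi>. indicator (B t) \<xi> \<partial>P)"
      by (simp add: sets_P)
    also have "\<dots> = c * (\<Sum>H\<in>?H. measure P H)"
      unfolding ind by (subst Bochner_Integration.integral_sum) (auto simp: sets_P emeasure_eq_measure)
    also have "\<dots> = (\<Sum>H\<in>?H. c * measure P H)"
      by (rule sum_distrib_left)
    \<comment> \<open>Each cylinder in \<open>?H\<close> is that of a path in \<open>B t\<close>,
      for which \<open>hit t\<close> is exactly this bound.\<close>
    also have "\<dots> \<le> (\<Sum>H\<in>?H. \<integral>\<xi>. indicator H \<xi> * f \<xi> \<partial>P)"
      by (rule sum_mono) (auto simp: B_def hit_def)
    also have "\<dots> = (\<integral>\<xi>. (\<Sum>H\<in>?H. indicator H \<xi> * f \<xi>) \<partial>P)"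
      using H_sets by (intro Bochner_Integration.integral_sum[symmetric] integrable_indicator_mult) (simp add: sets_P)
    also have "\<dots> = (\<integral>\<xi>. indicator (B t) \<xi> * f \<xi> \<partial>P)"
      by (simp add: ind sum_distrib_right)
    finally show ?thesis .
  qed
  have disj: "disjoint_family B"
    unfolding disjoint_family_on_def B_def by (auto, metis linorder_neqE_nat)
  have union: "{\<omega>. \<exists>t. hit t \<omega>} = (\<Union>t. B t)"
  proof (intro equalityI subsetI)
    fix \<omega> assume "\<omega> \<in> {\<omega>. \<exists>t. hit t \<omega>}"
    then have "\<omega> \<in> B (LEAST t. hit t \<omega>)"
      by (auto simp: B_def intro: LeastI dest: not_less_Least)
    then show "\<omega> \<in> (\<Union>t. B t)" by blast
  qed (auto simp: B_def)
  show "{\<omega>. \<exists>t. hit t \<omega>} \<in> sets P"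
    unfolding union by measurable
  have "(\<lambda>t. measure P (B t)) sums measure P (\<Union>t. B t)"
    by (rule finite_measure_UNION[OF _ disj]) (simp add: image_subset_iff sets_P)
  then have "(\<lambda>T. \<Sum>t<T. measure P (B t)) \<longlonglongrightarrow> measure P (\<Union>t. B t)"
    by (simp add: sums_def)
  moreover have "(\<Sum>t<T. measure P (B t)) \<le> (\<integral>\<xi>. f \<xi> \<partial>P) / c" for T
  proof -
    have "c * (\<Sum>t<T. measure P (B t)) \<le> (\<Sum>t<T. \<integral>\<xi>. indicator (B t) \<xi> * f \<xi> \<partial>P)"
      unfolding sum_distrib_left by (intro sum_mono B_le)
    also have "\<dots> = (\<integral>\<xi>. (\<Sum>t<T. indicator (B t) \<xi> * f \<xi>) \<partial>P)"
      by (intro Bochner_Integration.integral_sum[symmetric] integrable_indicator_mult) auto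
    \<comment> \<open>The first-passage events are disjoint and \<open>f\<close> is nonnegative, so
      the sum of the restricted integrands stays below \<open>f\<close>.\<close>
    also have "\<dots> \<le> (\<integral>\<xi>. f \<xi> \<partial>P)"
    proof (rule integral_mono)
      fix \<xi>
      have "(\<Sum>t<T. indicator (B t) \<xi> :: real) = indicator (\<Union>t<T. B t) \<xi>"
        by (rule indicator_UN_disjoint[symmetric]) (use disj in \<open>auto simp: disjoint_family_on_def\<close>)
      then have "(\<Sum>t<T. indicator (B t) \<xi> * f \<xi>) = indicator (\<Union>t<T. B t) \<xi> * f \<xi>"
        by (simp add: sum_distrib_right[symmetric])
      also have "\<dots> \<le> f \<xi>"
        using f(2)[of \<xi>] by (simp add: indicator_def)
      finally show "(\<Sum>t<T. indicator (B t) \<xi> * f \<xi>) \<le> f \<xi>" .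
    qed (rule Bochner_Integration.integrable_sum, rule integrable_indicator_mult, simp, rule f(1))
    finally show ?thesis
      using c by (simp add: field_simps)
  qed
  ultimately show "measure P {\<omega>. \<exists>t. hit t \<omega>} \<le> (\<integral>\<xi>. f \<xi> \<partial>P) / c"
    unfolding union by (auto intro: LIMSEQ_le_const2)
qed

section \<open>Exchangeable mixtures of i.i.d. laws\<close>

text \<open>The mixing law is kept abstract; the image measure \<open>mixing\<close> becomes an
  instance once it is known to be a probability law on the simplex.\<close>

locale simplex_prior = prob_space \<nu> for \<nu> :: "(real ^ 'k::finite) measure" +
  assumes sets_prior [measurable_cong, simp]: "sets \<nu> = sets simplex_borel"
begin

definition mixture :: "(nat \<Rightarrow> 'k) measure" where
  "mixture = \<nu> \<bind> iid_law"

lemma space_prior [simp]: "space \<nu> = prob_simplex"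
  using sets_eq_imp_space_eq[OF sets_prior] by simp

lemma measurable_iid_law_prior [measurable]: "iid_law \<in> \<nu> \<rightarrow>\<^sub>M subprob_algebra path_space"
  by measurable

lemma sets_mixture [measurable_cong, simp]: "sets mixture = sets path_space"
  unfolding mixture_def using not_empty by (intro sets_bind) auto

lemma space_mixture [simp]: "space mixture = UNIV"
  using sets_eq_imp_space_eq[OF sets_mixture] by simp

lemma prob_space_mixture: "prob_space mixture"
  unfolding mixture_def
  by (rule prob_space_bind[OF _ measurable_iid_law_prior]) (auto intro!: AE_I2 prob_space_iid_law)

sublocale mixture: prob_space mixture
  by (rule prob_space_mixture)

lemma integral_mixture:
  fixes f :: "(nat \<Rightarrow> 'k) \<Rightarrow> real"
  assumes "f \<in> borel_measurable path_space" "\<And>\<omega>. \<bar>f \<omega>\<bar> \<le> B"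
  shows "(\<integral>\<omega>. f \<omega> \<partial>mixture) = (\<integral>q. (\<integral>\<omega>. f \<omega> \<partial>iid_law q) \<partial>\<nu>)"
  unfolding mixture_def
proof (rule integral_bind[OF assms(1) _ measurable_iid_law_prior])
  show "AE q in \<nu>. emeasure (iid_law q) (space (iid_law q)) \<le> ennreal 1"
  proof (rule AE_I2)
    fix q assume "q \<in> space \<nu>"
    then have "prob_space (iid_law q)" by (intro prob_space_iid_law) simp
    then show "emeasure (iid_law q) (space (iid_law q)) \<le> ennreal 1"
      by (simp add: prob_space.emeasure_space_1 del: space_iid_law)
  qed
qed (use assms(2) in auto, unfold_locales)

lemma AE_mixture:
  assumes "Measurable.pred path_space P" "\<And>q. q \<in> prob_simplex \<Longrightarrow> AE \<omega> in iid_law q. P \<omega>"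
  shows "AE \<omega> in mixture. P \<omega>"
  unfolding mixture_def using assms by (subst AE_bind[where B = path_space]) auto

text \<open>Under \<open>iid_law q\<close> the limiting frequency is almost surely the constant
  \<open>q\<close>, so \<open>f (limit_freq \<omega>)\<close> leaves the inner integral as
  \<open>f q\<close>. Every joint statement about path and limiting frequency below reduces to this
  identity.\<close>

lemma integral_limit_freq:
  fixes f :: "real ^ 'k \<Rightarrow> real"
  assumes f [measurable]: "f \<in> borel_measurable simplex_borel" and A [measurable]: "A \<in> sets path_space"
    and B: "\<And>q. q \<in> prob_simplex \<Longrightarrow> \<bar>f q\<bar> \<le> B"
  shows "(\<integral>\<omega>. indicator A \<omega> * f (limit_freq \<omega>) \<partial>mixture) = (\<integral>q. f q * measure (iid_law q) A \<partial>\<nu>)"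
proof -
  have "(\<integral>\<omega>. indicator A \<omega> * f (limit_freq \<omega>) \<partial>mixture) =
      (\<integral>q. (\<integral>\<omega>. indicator A \<omega> * f (limit_freq \<omega>) \<partial>iid_law q) \<partial>\<nu>)"
  proof (rule integral_mixture)
    fix \<omega>
    show "\<bar>indicator A \<omega> * f (limit_freq \<omega>)\<bar> \<le> B"
      using B[OF limit_freq_in_prob_simplex[of \<omega>]] by (auto simp: indicator_def)
  qed measurable
  also have "\<dots> = (\<integral>q. f q * measure (iid_law q) A \<partial>\<nu>)"
  proof (rule Bochner_Integration.integral_cong[OF refl])
    fix q assume "q \<in> space \<nu>"
    then have q: "q \<in> prob_simplex" by simp
    have "(\<integral>\<omega>. indicator A \<omega> * f (limit_freq \<omega>) \<partial>iid_law q) = (\<integral>\<omega>. f q * indicator A \<omega> \<partial>iid_law q)"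
      by (rule integral_cong_AE) (measurable, use AE_iid_law_limit_freq[OF q] in auto)
    then show "(\<integral>\<omega>. indicator A \<omega> * f (limit_freq \<omega>) \<partial>iid_law q) = f q * measure (iid_law q) A"
      by simp
  qed
  finally show ?thesis .
qed

lemma measure_mixture_cylinder: "measure mixture (cylinder t h) = (\<integral>q. (\<Prod>j<t. q $ h j) \<partial>\<nu>)"
proof -
  have "measure mixture (cylinder t h) = (\<integral>q. measure (iid_law q) (cylinder t h) \<partial>\<nu>)"
    using integral_limit_freq[of "\<lambda>_. 1" "cylinder t h" 1] by simp
  also have "\<dots> = (\<integral>q. (\<Prod>j<t. q $ h j) \<partial>\<nu>)"
    by (intro Bochner_Integration.integral_cong refl) (simp add: measure_iid_law_history)
  finally show ?thesis .
qed

lemma measure_mixture_next_letter: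
  "measure mixture {\<omega>. \<omega> t = x \<and> (\<forall>j<t. \<omega> j = h j)} = (\<integral>q. q $ x * (\<Prod>j<t. q $ h j) \<partial>\<nu>)"
proof -
  \<comment> \<open>History and next letter form a history of length \<open>Suc t\<close>; updating
    \<open>h\<close> at index \<open>t\<close> leaves the first \<open>t\<close> factors
    unchanged.\<close>
  have "{\<omega>. \<omega> t = x \<and> (\<forall>j<t. \<omega> j = h j)} = cylinder (Suc t) (h(t := x))"
    by (auto simp: less_Suc_eq)
  then show ?thesis
    by (simp add: measure_mixture_cylinder mult.commute)
qed

text \<open>The right-hand side is also the probability of the history followed by \<open>x\<close>.
  Hence, on a cylinder of positive mass, the predictive probability of \<open>x\<close> is the
  average of \<open>limit_freq \<omega> $ x\<close> over that cylinder.\<close>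

lemma integral_limit_freq_cylinder:
  "(\<integral>\<omega>. indicator (cylinder t h) \<omega> * limit_freq \<omega> $ x \<partial>mixture) = (\<integral>q. q $ x * (\<Prod>j<t. q $ h j) \<partial>\<nu>)"
proof -
  have "(\<integral>\<omega>. indicator (cylinder t h) \<omega> * limit_freq \<omega> $ x \<partial>mixture) =
      (\<integral>q. q $ x * measure (iid_law q) (cylinder t h) \<partial>\<nu>)"
    by (rule integral_limit_freq[of _ _ 1]) (auto simp: prob_simplex_nonneg prob_simplex_le_1)
  also have "\<dots> = (\<integral>q. q $ x * (\<Prod>j<t. q $ h j) \<partial>\<nu>)"
    by (intro Bochner_Integration.integral_cong refl) (simp add: measure_iid_law_history)
  finally show ?thesis .
qed

lemma cond_prob_mixture:
  "cond_prob mixture (\<lambda>\<omega>. \<omega> t = x) (\<lambda>\<omega>. \<forall>j<t. \<omega> j = h j) =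
     (\<integral>q. q $ x * (\<Prod>j<t. q $ h j) \<partial>\<nu>) / (\<integral>q. (\<Prod>j<t. q $ h j) \<partial>\<nu>)"
  by (simp add: cond_prob_def measure_mixture_next_letter measure_mixture_cylinder)

lemma distr_limit_freq: "distr mixture simplex_borel limit_freq = \<nu>"
proof (rule measure_eqI)
  fix C :: "(real ^ 'k) set" assume "C \<in> sets (distr mixture simplex_borel limit_freq)"
  then have C [measurable]: "C \<in> sets simplex_borel" by simp
  have "measure mixture (limit_freq -` C) = (\<integral>\<omega>. indicator UNIV \<omega> * indicator C (limit_freq \<omega>) \<partial>mixture)"
    using measurable_sets[OF measurable_limit_freq C] by (simp add: indicator_vimage[symmetric])
  also have "\<dots> = (\<integral>q. indicator C q * measure (iid_law q) UNIV \<partial>\<nu>)"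
    by (rule integral_limit_freq[of _ _ 1]) (auto simp: UNIV_in_sets_path_space indicator_def)
  also have "\<dots> = (\<integral>q. indicator C q \<partial>\<nu>)"
    by (intro Bochner_Integration.integral_cong refl) (simp add: measure_iid_law_UNIV)
  also have "\<dots> = measure \<nu> C"
    using C sets.sets_into_space[OF C] by (simp add: Int_absorb2)
  finally show "emeasure (distr mixture simplex_borel limit_freq) C = emeasure \<nu> C"
    by (simp add: emeasure_distr mixture.emeasure_eq_measure emeasure_eq_measure)
qed simp

text \<open>Events of the generated sigma-algebra are preimages of Borel sets \<open>C\<close> under
  \<open>limit_freq\<close>. On each of them both sides of the defining identity of conditional
  expectation equal the integral of \<open>indicator C q * measure (iid_law q) A\<close>.\<close>

lemma directing_measure_limit_freq: "directing_measure mixture (\<lambda>\<omega>. \<omega>) limit_freq"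
  unfolding directing_measure_def
proof (intro conjI ballI)
  fix A :: "(nat \<Rightarrow> 'k) set" assume A [measurable]: "A \<in> sets path_space"
  let ?F = "vimage_algebra (space mixture) limit_freq simplex_borel"
  have limit_freq_F: "limit_freq \<in> ?F \<rightarrow>\<^sub>M simplex_borel"
    by (rule measurable_vimage_algebra1) (simp add: limit_freq_in_prob_simplex)
  interpret finite_measure_subalgebra mixture ?F
    by unfold_locales (simp add: subalgebra_def sets_image_in_sets[of path_space UNIV])
  have kernel [measurable]: "(\<lambda>q. measure (iid_law q) A) \<in> borel_measurable simplex_borel"
    by measurable
  have le_1: "measure (iid_law q) A \<le> 1" if "q \<in> prob_simplex" for q :: "real ^ 'k"
    using prob_space.prob_le_1[OF prob_space_iid_law[OF that]] .
  show "AE w in mixture. real_cond_exp mixture ?F (indicator ((\<lambda>\<omega>. \<omega>) -` A \<inter> space mixture)) w =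
      measure (iid_law (limit_freq w)) A"
  proof (rule real_cond_exp_charact)
    fix B assume "B \<in> sets ?F"
    then obtain C where C [measurable]: "C \<in> sets simplex_borel" and B: "B = limit_freq -` C"
      by (auto simp: sets_vimage_algebra2 limit_freq_in_prob_simplex)
    have "(\<integral>\<omega>\<in>B. (indicator ((\<lambda>\<omega>. \<omega>) -` A \<inter> space mixture) \<omega> :: real) \<partial>mixture) =
        (\<integral>\<omega>. indicator A \<omega> * indicator C (limit_freq \<omega>) \<partial>mixture)"
      unfolding set_lebesgue_integral_def
      by (intro Bochner_Integration.integral_cong refl) (auto simp: B indicator_def)
    also have "\<dots> = (\<integral>q. indicator C q * measure (iid_law q) A \<partial>\<nu>)"
      by (rule integral_limit_freq[of _ _ 1]) (auto simp: UNIV_in_sets_path_space indicator_def)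
    \<comment> \<open>The extra factor is 1; it gives the integrand the shape of
      \<open>integral_limit_freq\<close> with \<open>A = UNIV\<close>, which is then read from right
      to left.\<close>
    also have "\<dots> = (\<integral>q. (indicator C q * measure (iid_law q) A) * measure (iid_law q) UNIV \<partial>\<nu>)"
      by (intro Bochner_Integration.integral_cong refl) (simp add: measure_iid_law_UNIV)
    also have "\<dots> = (\<integral>\<omega>. indicator UNIV \<omega> * (indicator C (limit_freq \<omega>) * measure (iid_law (limit_freq \<omega>)) A) \<partial>mixture)"
      by (rule integral_limit_freq[symmetric, of _ _ 1]) (auto simp: UNIV_in_sets_path_space indicator_def le_1)
    also have "\<dots> = (\<integral>\<omega>\<in>B. measure (iid_law (limit_freq \<omega>)) A \<partial>mixture)"
      unfolding set_lebesgue_integral_def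
      by (intro Bochner_Integration.integral_cong refl) (auto simp: B indicator_def)
    finally show "(\<integral>\<omega>\<in>B. (indicator ((\<lambda>\<omega>. \<omega>) -` A \<inter> space mixture) \<omega> :: real) \<partial>mixture) =
        (\<integral>\<omega>\<in>B. measure (iid_law (limit_freq \<omega>)) A \<partial>mixture)" .
  next
    show "integrable mixture (indicator ((\<lambda>\<omega>. \<omega>) -` A \<inter> space mixture) :: _ \<Rightarrow> real)"
      using A by (simp add: mixture.emeasure_eq_measure)
    show "integrable mixture (\<lambda>\<omega>. measure (iid_law (limit_freq \<omega>)) A)"
      by (rule mixture.integrable_const_bound[where B = 1]) (auto simp: le_1 limit_freq_in_prob_simplex)
    show "(\<lambda>\<omega>. measure (iid_law (limit_freq \<omega>)) A) \<in> borel_measurable ?F"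
      using measurable_compose[OF limit_freq_F kernel] by (simp add: comp_def)
  qed
qed simp_all

section \<open>Almost sure convergence of the predictive probabilities\<close>

text \<open>Compare both quantities with \<open>empirical n \<omega> $ x\<close>. Outside
  \<open>bad n\<close> the limiting frequency is within \<open>e\<close> of it, and so is the
  predictive probability for all \<open>t \<ge> n\<close>. The mass of \<open>bad n\<close> tends to
  0 by Markov's inequality, the maximal inequality and dominated convergence.\<close>

lemma AE_predictive_tendsto_limit_freq:
  "AE \<omega> in mixture. (\<lambda>t. predictive mixture t \<omega>) \<longlonglongrightarrow> limit_freq \<omega>"
proof -
  have AE_close: "AE \<omega> in mixture. \<exists>n. \<forall>t\<ge>n. \<bar>predictive mixture t \<omega> $ x - limit_freq \<omega> $ x\<bar> < 2 * e"
    if e: "e > 0" for x :: 'k and e :: real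
  proof -
    let ?f = "\<lambda>n \<omega>. \<bar>limit_freq \<omega> $ x - empirical n \<omega> $ x\<bar>"
    have freq_nth [measurable]: "(\<lambda>\<omega>. limit_freq \<omega> $ x) \<in> borel_measurable path_space"
      using measurable_compose[OF measurable_limit_freq measurable_vec_nth_simplex] .
    have freq_bounds: "0 \<le> limit_freq \<omega> $ x" "limit_freq \<omega> $ x \<le> 1" for \<omega>
      using limit_freq_in_prob_simplex[of \<omega>] prob_simplex_le_1 by (auto simp: prob_simplex_def)
    have f_le: "?f n \<omega> \<le> 1" for n \<omega>
      using freq_bounds[of \<omega>] empirical_nth_bounds[of n \<omega> x] by (auto simp: abs_le_iff)
    have int_f: "integrable mixture (?f n)" for n
      by (rule mixture.integrable_const_bound[where B = 1]) (auto simp: f_le)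
    have f_lim: "(\<lambda>n. \<integral>\<omega>. ?f n \<omega> \<partial>mixture) \<longlonglongrightarrow> 0"
    proof -
      have "AE \<omega> in mixture. (\<lambda>n. ?f n \<omega>) \<longlonglongrightarrow> 0"
      proof (rule AE_mixture)
        fix q :: "real ^ 'k" assume q: "q \<in> prob_simplex"
        have "(\<lambda>n. \<bar>limit_freq \<omega> $ x - empirical n \<omega> $ x\<bar>) \<longlonglongrightarrow> 0"
          if "(\<lambda>n. empirical n \<omega>) \<longlonglongrightarrow> q" for \<omega>
          using tendsto_rabs[OF tendsto_diff[OF tendsto_const[of "q $ x"] tendsto_vec_nth[OF that, of x]]]
            limit_freq_eqI[OF that q] by simp
        then show "AE \<omega> in iid_law q. (\<lambda>n. ?f n \<omega>) \<longlonglongrightarrow> 0"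
          using AE_iid_law_empirical_tendsto[OF q] by auto
      qed measurable
      then have "(\<lambda>n. \<integral>\<omega>. ?f n \<omega> \<partial>mixture) \<longlonglongrightarrow> (\<integral>\<omega>. 0 \<partial>mixture)"
        by (intro integral_dominated_convergence[where w = "\<lambda>_. 1"]) (auto simp: f_le)
      then show ?thesis by simp
    qed
    \<comment> \<open>The form without division also counts every null cylinder as a hit, so a path
      without hits has only cylinders of positive mass.\<close>
    define hit where "hit n t \<omega> \<longleftrightarrow>
      e * measure mixture (cylinder t \<omega>) \<le> (\<integral>\<xi>. indicator (cylinder t \<omega>) \<xi> * ?f n \<xi> \<partial>mixture)" for n t \<omega>
    define bad where "bad n = {\<omega>. \<exists>t. hit n t \<omega>} \<union> {\<omega>. e \<le> ?f n \<omega>}" for n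
    have hit_sets: "{\<omega>. \<exists>t. hit n t \<omega>} \<in> sets mixture"
      and hit_le: "measure mixture {\<omega>. \<exists>t. hit n t \<omega>} \<le> (\<integral>\<omega>. ?f n \<omega> \<partial>mixture) / e" for n
      using cylinder_maximal_inequality[OF prob_space_mixture sets_mixture int_f[of n] _ e]
      unfolding hit_def by auto
    have dev_sets: "{\<omega>. e \<le> ?f n \<omega>} \<in> sets mixture" for n
      unfolding sets_mixture by (rule sets_path_space_Collect) measurable
    have bad_sets: "bad n \<in> sets mixture" for n
      unfolding bad_def using hit_sets dev_sets by (rule sets.Un)
    have bad_le: "measure mixture (bad n) \<le> 2 * (\<integral>\<omega>. ?f n \<omega> \<partial>mixture) / e" for n
    proof -
      have "measure mixture {\<omega>. e \<le> ?f n \<omega>} \<le> (\<integral>\<omega>. ?f n \<omega> \<partial>mixture) / e"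
        using integral_Markov_inequality_measure[OF int_f[of n], of "{}" e] e by simp
      then show ?thesis
        unfolding bad_def using measure_Un_le[OF hit_sets dev_sets, of n n] hit_le[of n] by simp
    qed
    \<comment> \<open>It suffices that almost every path avoids one of the sets
      \<open>bad n\<close>, and the intersection is at most as large as each of them.\<close>
    have "measure mixture (\<Inter>n. bad n) \<le> 0"
    proof (rule LIMSEQ_le_const)
      show "(\<lambda>n. 2 * (\<integral>\<omega>. ?f n \<omega> \<partial>mixture) / e) \<longlonglongrightarrow> 0"
        using tendsto_divide[OF tendsto_mult[OF tendsto_const[of 2] f_lim] tendsto_const[of e]] e by simp
      have "measure mixture (\<Inter>n. bad n) \<le> measure mixture (bad n)" for n
        using bad_sets by (intro mixture.finite_measure_mono) auto
      then show "\<exists>N. \<forall>n\<ge>N. measure mixture (\<Inter>n. bad n) \<le> 2 * (\<integral>\<omega>. ?f n \<omega> \<partial>mixture) / e"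
        using bad_le order_trans by blast
    qed
    then have "(\<Inter>n. bad n) \<in> null_sets mixture"
      using bad_sets by (intro null_setsI) (auto simp: mixture.emeasure_eq_measure measure_le_0_iff)
    then have "AE \<omega> in mixture. \<omega> \<notin> (\<Inter>n. bad n)"
      by (rule AE_not_in)
    then show ?thesis
    proof (rule AE_mp, intro AE_I2 impI)
      fix \<omega> assume "\<omega> \<notin> (\<Inter>n. bad n)"
      then obtain n where n: "\<And>t. \<not> hit n t \<omega>" "?f n \<omega> < e"
        by (auto simp: bad_def not_le)
      have "\<bar>predictive mixture t \<omega> $ x - limit_freq \<omega> $ x\<bar> < 2 * e" if t: "t \<ge> n" for t
      proof -
        let ?C = "cylinder t \<omega>"
        let ?m = "measure mixture ?C"
        have lt: "(\<integral>\<xi>. indicator ?C \<xi> * ?f n \<xi> \<partial>mixture) < e * ?m"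
          using n(1)[of t] by (simp add: hit_def not_le)
        have "0 \<le> (\<integral>\<xi>. indicator ?C \<xi> * ?f n \<xi> \<partial>mixture)"
          by (intro integral_nonneg_AE AE_I2) auto
        with lt have "0 < e * ?m" by linarith
        then have m: "?m > 0"
          using e by (simp add: zero_less_mult_iff)
        \<comment> \<open>From time \<open>n\<close> on, the first \<open>n\<close> letters are
          fixed on the cylinder, so the approximant is constant there and \<open>?f n\<close>
          measures the distance to a single number.\<close>
        have emp: "empirical n \<xi> = empirical n \<omega>" if "\<xi> \<in> ?C" for \<xi>
          using that t by (auto simp: empirical_def)
        have int1: "integrable mixture (\<lambda>\<xi>. indicator ?C \<xi> * limit_freq \<xi> $ x)"
          by (rule mixture.integrable_const_bound[where B = 1]) (auto simp: indicator_def freq_bounds)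
        have int2: "integrable mixture (\<lambda>\<xi>. empirical n \<omega> $ x * indicator ?C \<xi>)"
          by (rule mixture.integrable_const_bound[where B = 1]) (auto simp: indicator_def empirical_nth_bounds)
        have "(predictive mixture t \<omega> $ x - empirical n \<omega> $ x) * ?m =
            (\<integral>\<xi>. indicator ?C \<xi> * limit_freq \<xi> $ x \<partial>mixture) - (\<integral>\<xi>. empirical n \<omega> $ x * indicator ?C \<xi> \<partial>mixture)"
          using m by (simp add: predictive_def cond_prob_mixture integral_limit_freq_cylinder
              measure_mixture_cylinder[symmetric] left_diff_distrib)
        also have "\<dots> = (\<integral>\<xi>. indicator ?C \<xi> * limit_freq \<xi> $ x - empirical n \<omega> $ x * indicator ?C \<xi> \<partial>mixture)"
          by (rule Bochner_Integration.integral_diff[symmetric]) (fact int1 int2)+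
        also have "\<bar>\<dots>\<bar> \<le> (\<integral>\<xi>. \<bar>indicator ?C \<xi> * limit_freq \<xi> $ x - empirical n \<omega> $ x * indicator ?C \<xi>\<bar> \<partial>mixture)"
          by (rule integral_abs_bound)
        also have "\<dots> = (\<integral>\<xi>. indicator ?C \<xi> * ?f n \<xi> \<partial>mixture)"
        proof (intro Bochner_Integration.integral_cong refl)
          fix \<xi>
          show "\<bar>indicator ?C \<xi> * limit_freq \<xi> $ x - empirical n \<omega> $ x * indicator ?C \<xi>\<bar> = indicator ?C \<xi> * ?f n \<xi>"
            by (cases "\<xi> \<in> ?C") (use emp[of \<xi>] in \<open>simp_all del: mem_Collect_eq\<close>)
        qed
        finally have "\<bar>predictive mixture t \<omega> $ x - empirical n \<omega> $ x\<bar> * ?m \<le> (\<integral>\<xi>. indicator ?C \<xi> * ?f n \<xi> \<partial>mixture)"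
          using m by (simp add: abs_mult)
        from le_less_trans[OF this lt] have "\<bar>predictive mixture t \<omega> $ x - empirical n \<omega> $ x\<bar> < e"
          using m by simp
        with n(2) show ?thesis by linarith
      qed
      then show "\<exists>n. \<forall>t\<ge>n. \<bar>predictive mixture t \<omega> $ x - limit_freq \<omega> $ x\<bar> < 2 * e"
        by blast
    qed
  qed
  have "AE \<omega> in mixture. \<forall>x. \<forall>k. \<exists>n. \<forall>t\<ge>n. \<bar>predictive mixture t \<omega> $ x - limit_freq \<omega> $ x\<bar> < 2 * (1 / Suc k)"
    by (simp only: AE_all_countable AE_finite_all) (intro allI AE_close, simp)
  then show ?thesis
  proof (rule AE_mp, intro AE_I2 impI)
    fix \<omega> assume *: "\<forall>x k. \<exists>n. \<forall>t\<ge>n. \<bar>predictive mixture t \<omega> $ x - limit_freq \<omega> $ x\<bar> < 2 * (1 / Suc k)"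
    show "(\<lambda>t. predictive mixture t \<omega>) \<longlonglongrightarrow> limit_freq \<omega>"
    proof (intro vec_tendstoI tendstoI)
      fix x and e :: real assume "e > 0"
      then obtain k where "1 / Suc k < e / 2" using nat_approx_posE[of "e / 2"] by auto
      moreover obtain n where "\<forall>t\<ge>n. \<bar>predictive mixture t \<omega> $ x - limit_freq \<omega> $ x\<bar> < 2 * (1 / Suc k)"
        using * by blast
      ultimately show "\<forall>\<^sub>F t in sequentially. dist (predictive mixture t \<omega> $ x) (limit_freq \<omega> $ x) < e"
        unfolding eventually_sequentially dist_real_def by (intro exI[of _ n]) force
    qed
  qed
qed

end

text \<open>A directing measure is a.s. the limiting frequency: on \<open>Q \<in> C\<close> the path is i.i.d. with law in \<open>C\<close>,
  so its frequencies cannot converge outside \<open>C\<close>; let \<open>C\<close> range over a countable base.\<close>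

lemma directing_measure_eq_limit_freq:
  fixes X :: "'w \<Rightarrow> nat \<Rightarrow> 'k::finite"
  assumes \<Omega>: "prob_space \<Omega>" and dir: "directing_measure \<Omega> X Q"
  shows "AE w in \<Omega>. Q w = limit_freq (X w)"
proof -
  interpret prob_space \<Omega> by fact
  have X [measurable]: "X \<in> \<Omega> \<rightarrow>\<^sub>M path_space" and Q [measurable]: "Q \<in> \<Omega> \<rightarrow>\<^sub>M simplex_borel"
    and cond: "\<And>A. A \<in> sets path_space \<Longrightarrow> AE w in \<Omega>.
        real_cond_exp \<Omega> (vimage_algebra (space \<Omega>) Q simplex_borel) (indicator (X -` A \<inter> space \<Omega>)) w =
        measure (iid_law (Q w)) A"
    using dir by (auto simp: directing_measure_def)
  let ?F = "vimage_algebra (space \<Omega>) Q simplex_borel"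
  have Q_simplex: "Q w \<in> prob_simplex" if "w \<in> space \<Omega>" for w
    using measurable_space[OF Q that] by simp
  interpret finite_measure_subalgebra \<Omega> ?F
    by unfold_locales (simp add: subalgebra_def sets_image_in_sets[OF refl Q])
  have null: "AE w in \<Omega>. \<not> (Q w \<in> C \<and> limit_freq (X w) \<notin> C)" if C [measurable]: "C \<in> sets simplex_borel" for C
  proof -
    \<comment> \<open>These paths are null under every \<open>iid_law q\<close> with
      \<open>q \<in> C\<close>, since there the limiting frequency is almost surely
      \<open>q\<close>.\<close>
    let ?A = "limit_freq -` (prob_simplex - C) :: (nat \<Rightarrow> 'k) set"
    let ?B = "Q -` C \<inter> space \<Omega>"
    have "prob_simplex - C \<in> sets simplex_borel"
      using sets.compl_sets[OF C] by simp
    then have A [measurable]: "?A \<in> sets path_space"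
      using measurable_sets[OF measurable_limit_freq, of "prob_simplex - C"] by simp
    have XA [measurable]: "X -` ?A \<inter> space \<Omega> \<in> sets \<Omega>"
      using X A by (rule measurable_sets)
    have B: "?B \<in> sets ?F"
      using C by (rule in_vimage_algebra)
    have iid: "measure (iid_law q) ?A = 0" if "q \<in> prob_simplex" "q \<in> C" for q
    proof -
      have "AE \<omega> in iid_law q. \<omega> \<notin> ?A"
        using AE_iid_law_limit_freq[OF that(1)] that(2) by auto
      then have "measure (iid_law q) ?A = measure (iid_law q) {}"
        by (intro measure_eq_AE) (use A in auto)
      then show ?thesis by simp
    qed
    \<comment> \<open>As \<open>?B\<close> lies in the sigma-algebra of \<open>Q\<close>, the
      indicator may be replaced by its conditional expectation, which on \<open>?B\<close> is almost
      surely \<open>measure (iid_law (Q w)) ?A = 0\<close>.\<close>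
    have "measure \<Omega> (?B \<inter> (X -` ?A \<inter> space \<Omega>)) = (\<integral>w\<in>?B. indicator (X -` ?A \<inter> space \<Omega>) w \<partial>\<Omega>)"
      using C by (simp add: set_lebesgue_integral_def indicator_inter_arith[symmetric] del: vimage_Int)
    also have "\<dots> = (\<integral>w\<in>?B. real_cond_exp \<Omega> ?F (indicator (X -` ?A \<inter> space \<Omega>)) w \<partial>\<Omega>)"
      using B XA by (intro real_cond_exp_intA) (simp_all add: emeasure_eq_measure)
    also have "\<dots> = (\<integral>w\<in>?B. 0 \<partial>\<Omega>)"
      unfolding set_lebesgue_integral_def
    proof (rule integral_cong_AE)
      show "AE w in \<Omega>. indicator ?B w *\<^sub>R real_cond_exp \<Omega> ?F (indicator (X -` ?A \<inter> space \<Omega>)) w =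
          indicator ?B w *\<^sub>R (0 :: real)"
        using cond[OF A] by eventually_elim (auto simp: indicator_def iid Q_simplex)
    qed measurable
    finally have "measure \<Omega> (?B \<inter> (X -` ?A \<inter> space \<Omega>)) = 0"
      by (simp add: set_lebesgue_integral_def)
    then have "?B \<inter> (X -` ?A \<inter> space \<Omega>) \<in> null_sets \<Omega>"
      by (intro null_setsI) (auto simp: emeasure_eq_measure)
    then have "AE w in \<Omega>. w \<notin> ?B \<inter> (X -` ?A \<inter> space \<Omega>)"
      by (rule AE_not_in)
    with AE_space show ?thesis
      by eventually_elim (use limit_freq_in_prob_simplex in auto)
  qed
  \<comment> \<open>A countable base separates distinct points, so discarding countably many null
    sets is enough.\<close>
  obtain \<B> :: "(real ^ 'k) set set" where \<B>: "countable \<B>" "topological_basis \<B>"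
    using ex_countable_basis by blast
  have "AE w in \<Omega>. \<forall>U\<in>\<B>. \<not> (Q w \<in> U \<inter> prob_simplex \<and> limit_freq (X w) \<notin> U \<inter> prob_simplex)"
    unfolding AE_ball_countable[OF \<B>(1)]
  proof (intro ballI null)
    fix U assume "U \<in> \<B>"
    then have "U \<in> sets borel"
      using topological_basis_open[OF \<B>(2)] by (intro borel_open)
    then show "U \<inter> prob_simplex \<in> sets simplex_borel"
      unfolding sets_restrict_space by (rule image_eqI[rotated]) auto
  qed
  with AE_space show ?thesis
  proof eventually_elim
    fix w assume w: "w \<in> space \<Omega>"
      and *: "\<forall>U\<in>\<B>. \<not> (Q w \<in> U \<inter> prob_simplex \<and> limit_freq (X w) \<notin> U \<inter> prob_simplex)"
    show "Q w = limit_freq (X w)"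
    proof (rule ccontr)
      assume "Q w \<noteq> limit_freq (X w)"
      then obtain V where "open V" "Q w \<in> V" "limit_freq (X w) \<notin> V"
        using t1_space by blast
      then obtain U where "U \<in> \<B>" "Q w \<in> U" "U \<subseteq> V"
        using topological_basisE[OF \<B>(2)] by metis
      then show False
        using * Q_simplex[OF w] \<open>limit_freq (X w) \<notin> V\<close> by blast
    qed
  qed
qed

subsection \<open>Measurability of the information projection\<close>

text \<open>The value at 0 is 0, and so is the limit from the right; entropy terms are thus
  continuous up to the boundary of the simplex.\<close>

lemma continuous_on_mult_ln: "continuous_on {0..} (\<lambda>x::real. x * ln x)"
  unfolding continuous_on_def
proof
  fix a :: real assume "a \<in> {0..}"
  show "((\<lambda>x. x * ln x) \<longlongrightarrow> a * ln a) (at a within {0..})"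
  proof (cases "a = 0")
    case True
    have "((\<lambda>x::real. x * ln x) \<longlongrightarrow> 0) (at_right 0)" by real_asymp
    then show ?thesis
      using True by (simp add: at_within_Ici_at_right)
  next
    case False
    then show ?thesis by (intro tendsto_intros) auto
  qed
qed

text \<open>Adding \<open>c - m < c * (ln c - ln m)\<close> for \<open>c = a\<close> and
  \<open>c = b\<close> cancels the linear terms, as \<open>a + b = 2 * m\<close>. For
  \<open>c > 0\<close> the inequality is \<open>ln u < u - 1\<close> at \<open>u = m / c\<close>;
  for \<open>c = 0\<close> it reads \<open>- m < 0\<close>.\<close>

lemma mult_ln_midpoint:
  fixes a b :: real
  assumes "0 \<le> a" "0 \<le> b"
  defines "m \<equiv> (a + b) / 2"
  shows "2 * (m * ln m) \<le> a * ln a + b * ln b"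
    and "a \<noteq> b \<Longrightarrow> 2 * (m * ln m) < a * ln a + b * ln b"
proof -
  have strict: "c - m < c * (ln c - ln m)" if "0 \<le> c" "m > 0" "c \<noteq> m" for c
  proof (cases "c = 0")
    case False
    with that have "c > 0" by simp
    have "m / c > 0" "m / c \<noteq> 1"
      using \<open>c > 0\<close> that by auto
    then have "ln (m / c) < m / c - 1"
      using ln_le_minus_one[of "m / c"] ln_eq_minus_one[of "m / c"] by linarith
    then have "c * ln (m / c) < c * (m / c - 1)"
      using \<open>c > 0\<close> by simp
    then show ?thesis
      using \<open>c > 0\<close> \<open>m > 0\<close> by (simp add: ln_div algebra_simps)
  qed (use that in simp)
  show "2 * (m * ln m) < a * ln a + b * ln b" if "a \<noteq> b"
  proof -
    have "m > 0" "a \<noteq> m" "b \<noteq> m"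
      using assms that by (auto simp: m_def)
    have "a - m + (b - m) < a * (ln a - ln m) + b * (ln b - ln m)"
      using strict[OF \<open>0 \<le> a\<close> \<open>m > 0\<close> \<open>a \<noteq> m\<close>] strict[OF \<open>0 \<le> b\<close> \<open>m > 0\<close> \<open>b \<noteq> m\<close>] by linarith
    moreover have "a - m + (b - m) = 0"
      by (simp add: m_def field_simps)
    moreover have "a * (ln a - ln m) + b * (ln b - ln m) = a * ln a + b * ln b - 2 * (m * ln m)"
      by (simp add: m_def field_simps)
    ultimately show ?thesis by linarith
  qed
  then show "2 * (m * ln m) \<le> a * ln a + b * ln b"
    by (cases "a = b") (auto simp: m_def)
qed

section \<open>Relative entropy on the open faces of the simplex\<close>

text \<open>Fixing the support of the reference law \<open>\<mu>\<close> makes finiteness of the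
  entropy a condition on \<open>q\<close> alone.\<close>

definition open_face :: "'k::finite set \<Rightarrow> (real ^ 'k) set" where
  "open_face S = {\<mu> \<in> prob_simplex. \<forall>x. \<mu> $ x = 0 \<longleftrightarrow> x \<notin> S}"

text \<open>The points of \<open>E\<close> at finite relative entropy from any reference law in
  \<open>open_face S\<close>.\<close>

definition supported_on :: "'k::finite set \<Rightarrow> (real ^ 'k) set \<Rightarrow> (real ^ 'k) set" where
  "supported_on S E = {q \<in> E. \<forall>x. x \<notin> S \<longrightarrow> q $ x = 0}"

text \<open>Relative entropy with the logarithm of the quotient split: the first term is continuous
  also where \<open>q $ x = 0\<close>, and the second only needs \<open>\<mu> $ x > 0\<close>, which
  holds on the face.\<close>

definition face_entropy :: "'k::finite set \<Rightarrow> real ^ 'k \<Rightarrow> real ^ 'k \<Rightarrow> real" where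
  "face_entropy S q \<mu> = (\<Sum>x\<in>S. q $ x * ln (q $ x) - q $ x * ln (\<mu> $ x))"

lemma rel_entropy_open_face:
  assumes \<mu>: "\<mu> \<in> open_face S" and q: "q \<in> prob_simplex"
  shows "rel_entropy q \<mu> = (if \<forall>x. x \<notin> S \<longrightarrow> q $ x = 0 then ereal (face_entropy S q \<mu>) else \<infinity>)"
proof (cases "\<forall>x. x \<notin> S \<longrightarrow> q $ x = 0")
  case True
  have "(\<Sum>x\<in>UNIV. q $ x * ln (q $ x / \<mu> $ x)) = (\<Sum>x\<in>S. q $ x * ln (q $ x / \<mu> $ x))"
    using True by (intro sum.mono_neutral_right) auto
  also have "\<dots> = face_entropy S q \<mu>"
    unfolding face_entropy_def
  proof (intro sum.cong refl)
    fix x assume "x \<in> S"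
    then have "\<mu> $ x > 0"
      using \<mu> by (auto simp: open_face_def prob_simplex_nonneg order.strict_iff_order)
    then show "q $ x * ln (q $ x / \<mu> $ x) = q $ x * ln (q $ x) - q $ x * ln (\<mu> $ x)"
      using prob_simplex_nonneg[OF q, of x]
      by (cases "q $ x = 0") (simp_all add: ln_div right_diff_distrib)
  qed
  finally show ?thesis
    using True \<mu> by (auto simp: rel_entropy_def open_face_def)
next
  case False
  then show ?thesis
    using \<mu> by (auto simp: rel_entropy_def open_face_def)
qed

text \<open>Once some point of \<open>E\<close> has finite entropy, points of infinite entropy
  cannot be minimizers, and the extended-valued problem becomes a real one.\<close>

lemma is_arg_min_rel_entropy_iff:
  assumes E: "E \<subseteq> prob_simplex" and \<mu>: "\<mu> \<in> open_face S" and ne: "supported_on S E \<noteq> {}"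
  shows "is_arg_min (\<lambda>q. rel_entropy q \<mu>) (\<lambda>q. q \<in> E) q \<longleftrightarrow>
    q \<in> supported_on S E \<and> (\<forall>q'\<in>supported_on S E. face_entropy S q \<mu> \<le> face_entropy S q' \<mu>)"
proof -
  have eq: "rel_entropy p \<mu> = (if p \<in> supported_on S E then ereal (face_entropy S p \<mu>) else \<infinity>)" if "p \<in> E" for p
    using rel_entropy_open_face[OF \<mu> subsetD[OF E that]] that by (auto simp: supported_on_def)
  have sub: "supported_on S E \<subseteq> E"
    by (auto simp: supported_on_def)
  obtain p where p: "p \<in> supported_on S E" using ne by blast
  show ?thesis
  proof
    assume L: "is_arg_min (\<lambda>q. rel_entropy q \<mu>) (\<lambda>q. q \<in> E) q"
    then have q: "q \<in> E" and min: "\<And>q'. q' \<in> E \<Longrightarrow> \<not> rel_entropy q' \<mu> < rel_entropy q \<mu>"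
      by (auto simp: is_arg_min_def)
    have "q \<in> supported_on S E"
      using min[of p] p sub q by (auto simp: eq subsetD split: if_splits)
    moreover have "face_entropy S q \<mu> \<le> face_entropy S q' \<mu>" if "q' \<in> supported_on S E" for q'
      using min[of q'] sub that calculation by (auto simp: eq subsetD)
    ultimately show "q \<in> supported_on S E \<and> (\<forall>q'\<in>supported_on S E. face_entropy S q \<mu> \<le> face_entropy S q' \<mu>)"
      by blast
  next
    assume "q \<in> supported_on S E \<and> (\<forall>q'\<in>supported_on S E. face_entropy S q \<mu> \<le> face_entropy S q' \<mu>)"
    then show "is_arg_min (\<lambda>q. rel_entropy q \<mu>) (\<lambda>q. q \<in> E) q"
      using sub by (auto simp: is_arg_min_def eq subsetD not_less)
  qed
qed

text \<open>The midpoint of two distinct minimizers would have smaller entropy: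
  \<open>x * ln x\<close> is strictly convex and the term with \<open>ln (\<mu> $ x)\<close> is
  linear in \<open>q\<close>.\<close>

lemma face_entropy_minimizer_unique:
  assumes C: "convex C" "C \<subseteq> prob_simplex" "\<And>q x. q \<in> C \<Longrightarrow> x \<notin> S \<Longrightarrow> q $ x = 0"
    and q1: "q1 \<in> C" "\<And>q. q \<in> C \<Longrightarrow> face_entropy S q1 \<mu> \<le> face_entropy S q \<mu>"
    and q2: "q2 \<in> C" "\<And>q. q \<in> C \<Longrightarrow> face_entropy S q2 \<mu> \<le> face_entropy S q \<mu>"
  shows "q1 = q2"
proof (rule ccontr)
  assume "q1 \<noteq> q2"
  then obtain x where x: "q1 $ x \<noteq> q2 $ x" by (auto simp: vec_eq_iff)
  then have xS: "x \<in> S" using C(3) q1(1) q2(1) by metis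
  define m where "m = (1 / 2) *\<^sub>R q1 + (1 / 2) *\<^sub>R q2"
  have m: "m \<in> C"
    unfolding m_def using q1(1) q2(1) C(1) by (intro convexD) auto
  have m_nth: "m $ y = (q1 $ y + q2 $ y) / 2" for y
    by (simp add: m_def field_simps)
  have nonneg: "0 \<le> q1 $ y" "0 \<le> q2 $ y" for y
    using C(2) q1(1) q2(1) prob_simplex_nonneg by blast+
  let ?t = "\<lambda>q y. q $ y * ln (q $ y) - q $ y * ln (\<mu> $ y)"
  have le: "2 * ?t m y \<le> ?t q1 y + ?t q2 y" for y
    using mult_ln_midpoint(1)[OF nonneg, of y y] by (simp add: m_nth field_simps)
  have less: "2 * ?t m x < ?t q1 x + ?t q2 x"
    using mult_ln_midpoint(2)[OF nonneg x] by (simp add: m_nth field_simps)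
  have "2 * face_entropy S m \<mu> < face_entropy S q1 \<mu> + face_entropy S q2 \<mu>"
    unfolding face_entropy_def sum_distrib_left sum.distrib[symmetric]
    by (rule sum_strict_mono_ex1) (use le less xS in auto)
  with q1(2)[OF m] q2(2)[OF m] show False by linarith
qed

text \<open>Letting both arguments depend on a parameter \<open>z\<close> covers minimization at
  fixed \<open>\<mu>\<close> as well as joint continuity for the graph argument.\<close>

lemma continuous_on_face_entropy:
  assumes q: "continuous_on T q" and \<mu>: "continuous_on T \<mu>"
    and "q ` T \<subseteq> prob_simplex" "\<mu> ` T \<subseteq> open_face S"
  shows "continuous_on T (\<lambda>z. face_entropy S (q z) (\<mu> z))"
proof -
  have q_nth: "continuous_on T (\<lambda>z. q z $ x)" for x
    by (intro continuous_intros q)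
  have qln: "continuous_on T (\<lambda>z. q z $ x * ln (q z $ x))" for x
    using continuous_on_compose2[OF continuous_on_mult_ln q_nth, of x] assms(3) prob_simplex_nonneg by blast
  have \<mu>_nth: "continuous_on T (\<lambda>z. \<mu> z $ x)" for x
    by (intro continuous_intros \<mu>)
  show ?thesis
    unfolding face_entropy_def
    by (intro continuous_on_sum continuous_on_diff qln continuous_on_mult q_nth continuous_on_ln
        \<mu>_nth) (use assms(4) in \<open>auto simp: open_face_def\<close>)
qed

lemma bounded_prob_simplex: "bounded (prob_simplex :: (real ^ 'k::finite) set)"
proof (rule boundedI)
  fix q :: "real ^ 'k" assume q: "q \<in> prob_simplex"
  have "norm q \<le> (\<Sum>x\<in>UNIV. \<bar>q $ x\<bar>)"
    by (rule norm_le_l1_cart)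
  also have "\<dots> = 1"
    using q by (simp add: prob_simplex_def)
  finally show "norm q \<le> 1" .
qed

lemma compact_supported_on:
  assumes "E \<subseteq> prob_simplex" "closed E"
  shows "compact (supported_on S E)"
  unfolding compact_eq_bounded_closed
proof
  have "supported_on S E = E \<inter> (\<Inter>x\<in>- S. {q. q $ x = 0})"
    by (auto simp: supported_on_def)
  also have "closed \<dots>"
    by (intro closed_Int assms closed_INT ballI closed_Collect_eq continuous_intros)
  finally show "closed (supported_on S E)" .
  show "bounded (supported_on S E)"
    by (rule bounded_subset[OF bounded_prob_simplex]) (use assms(1) in \<open>auto simp: supported_on_def\<close>)
qed

text \<open>\<open>info_proj\<close> is a choice, so a minimizer must be shown to exist: by
  compactness if some entropy is finite; if all are infinite, every point of \<open>E\<close> is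
  one.\<close>

lemma is_arg_min_info_proj:
  assumes E: "E \<subseteq> prob_simplex" "closed E" "E \<noteq> {}" and \<mu>: "\<mu> \<in> open_face S"
  shows "is_arg_min (\<lambda>q. rel_entropy q \<mu>) (\<lambda>q. q \<in> E) (info_proj E \<mu>)"
proof -
  have "\<exists>q. is_arg_min (\<lambda>q. rel_entropy q \<mu>) (\<lambda>q. q \<in> E) q"
  proof (cases "supported_on S E = {}")
    case True
    then have "rel_entropy q \<mu> = \<infinity>" if "q \<in> E" for q
      using rel_entropy_open_face[OF \<mu>, of q] that E(1) by (auto simp: supported_on_def)
    then show ?thesis
      using E(3) by (auto simp: is_arg_min_def)
  next
    case False
    have "compact (supported_on S E)"
      by (rule compact_supported_on) fact+
    moreover have "continuous_on (supported_on S E) (\<lambda>q. face_entropy S q \<mu>)"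
      using E(1) \<mu> by (intro continuous_on_face_entropy continuous_intros) (auto simp: supported_on_def)
    ultimately show ?thesis
      using continuous_attains_inf[OF _ False] unfolding is_arg_min_rel_entropy_iff[OF E(1) \<mu> False] by blast
  qed
  then show ?thesis
    unfolding info_proj_def arg_min_on_def arg_min_def by (rule someI_ex)
qed

lemma info_proj_in:
  assumes "E \<subseteq> prob_simplex" "closed E" "E \<noteq> {}" and \<mu>: "\<mu> \<in> prob_simplex"
  shows "info_proj E \<mu> \<in> E"
proof -
  have "\<mu> \<in> open_face {x. \<mu> $ x \<noteq> 0}"
    using \<mu> by (simp add: open_face_def)
  from is_arg_min_info_proj[OF assms(1-3) this] show ?thesis
    by (simp add: is_arg_min_def)
qed

text \<open>A map into a compact set is continuous if its graph is closed.\<close>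

lemma continuous_on_info_proj:
  assumes E: "E \<subseteq> prob_simplex" "closed E" "E \<noteq> {}" "convex E"
  shows "continuous_on (open_face S) (info_proj E)"
proof (cases "supported_on S E = {}")
  case True
  \<comment> \<open>The predicate of being a minimizer is the same for every \<open>\<mu>\<close> in
    the face, so the choice operator returns the same point throughout.\<close>
  have "info_proj E \<mu> = (SOME q. q \<in> E)" if "\<mu> \<in> open_face S" for \<mu>
  proof -
    have "rel_entropy q \<mu> = \<infinity>" if "q \<in> E" for q
      using rel_entropy_open_face[OF \<open>\<mu> \<in> open_face S\<close>, of q] True that E(1) by (auto simp: supported_on_def)
    then have "is_arg_min (\<lambda>q. rel_entropy q \<mu>) (\<lambda>q. q \<in> E) = (\<lambda>q. q \<in> E)"
      by (auto simp: is_arg_min_def fun_eq_iff)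
    then show ?thesis
      by (simp add: info_proj_def arg_min_on_def arg_min_def)
  qed
  then show ?thesis
    using continuous_on_cong[of "open_face S" "open_face S" "info_proj E" "\<lambda>_. SOME q. q \<in> E"] by simp
next
  case False
  let ?K = "supported_on S E"
  have K: "?K \<subseteq> prob_simplex"
    using E(1) by (auto simp: supported_on_def)
  have "convex ?K"
    using E(4) by (auto simp: supported_on_def convex_def)
  note unique = face_entropy_minimizer_unique[OF this K, of S]
  have argmin: "info_proj E \<mu> \<in> ?K \<and> (\<forall>q\<in>?K. face_entropy S (info_proj E \<mu>) \<mu> \<le> face_entropy S q \<mu>)"
    if "\<mu> \<in> open_face S" for \<mu>
    using is_arg_min_info_proj[OF E(1-3) that] is_arg_min_rel_entropy_iff[OF E(1) that False] by blast
  have eq_info_proj: "q = info_proj E \<mu>"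
    if "\<mu> \<in> open_face S" "q \<in> ?K" "\<forall>q'\<in>?K. face_entropy S q \<mu> \<le> face_entropy S q' \<mu>" for \<mu> q
    using argmin[OF that(1)] that by (intro unique) (auto simp: supported_on_def)
  let ?T = "open_face S \<times> ?K"
  \<comment> \<open>By uniqueness, being the minimizer amounts to one closed condition for each
    competitor \<open>q'\<close>.\<close>
  have graph: "(\<lambda>\<mu>. (\<mu>, info_proj E \<mu>)) ` open_face S =
      (\<Inter>q'\<in>?K. {z \<in> ?T. face_entropy S (snd z) (fst z) - face_entropy S q' (fst z) \<in> {..0}})"
    using argmin eq_info_proj False by (auto simp: image_iff)
  have "closedin (top_of_set ?T) \<dots>"
  proof (rule closedin_INT)
    fix q' assume q': "q' \<in> ?K"
    let ?f = "\<lambda>z. face_entropy S (snd z) (fst z) - face_entropy S q' (fst z)"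
    have "continuous_on ?T ?f"
      using K q' by (intro continuous_on_diff continuous_on_face_entropy continuous_intros) auto
    then have "closedin (top_of_set ?T) (?T \<inter> ?f -` {..0})"
      by (rule continuous_closedin_preimage) simp
    then show "closedin (top_of_set ?T) {z \<in> ?T. ?f z \<in> {..0}}"
      by (simp add: vimage_def Int_def)
  qed (fact False)
  then show ?thesis
    using continuous_closed_graph_eq[OF compact_supported_on[OF E(1,2)], of "info_proj E" "open_face S" S] argmin
    by (simp add: graph Pi_iff)
qed

text \<open>Finitely many Borel faces cover the simplex, and continuity on each of them gives
  measurability of the whole map.\<close>

lemma measurable_info_proj:
  fixes E :: "(real ^ 'k::finite) set"
  assumes E: "E \<subseteq> prob_simplex" "closed E" "E \<noteq> {}" "convex E"
  shows "info_proj E \<in> simplex_borel \<rightarrow>\<^sub>M simplex_borel"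
proof (rule measurable_restrict_space2)
  show "info_proj E \<in> space simplex_borel \<rightarrow> prob_simplex"
    using info_proj_in[OF E(1-3)] E(1) by auto
  show "info_proj E \<in> borel_measurable simplex_borel"
  proof (rule measurable_piecewise_restrict)
    show "countable (range (open_face :: 'k set \<Rightarrow> _))"
      by (intro countable_finite finite_imageI) simp
    show "space (simplex_borel :: (real ^ 'k) measure) \<subseteq> \<Union>(range open_face)"
    proof
      fix \<mu> :: "real ^ 'k" assume "\<mu> \<in> space simplex_borel"
      then have "\<mu> \<in> open_face {x. \<mu> $ x \<noteq> 0}"
        by (simp add: open_face_def)
      then show "\<mu> \<in> \<Union>(range open_face)" by blast
    qed
    fix F :: "(real ^ 'k) set" assume "F \<in> range open_face"
    then obtain S where F: "F = open_face S" by blast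
    have simplex_sets [measurable]: "(prob_simplex :: (real ^ 'k) set) \<in> sets borel"
      by (rule borel_closed[OF closed_prob_simplex])
    have "{\<mu> \<in> space borel. \<mu> \<in> prob_simplex \<and> (\<forall>x. \<mu> $ x = 0 \<longleftrightarrow> x \<notin> S)} \<in> sets borel"
      by measurable
    then have F_sets: "F \<in> sets borel"
      by (simp add: F open_face_def)
    have F_sub: "F \<subseteq> prob_simplex"
      by (auto simp: F open_face_def)
    show "F \<inter> space simplex_borel \<in> sets simplex_borel"
      using F_sets F_sub by (auto simp: sets_restrict_space intro!: image_eqI[of _ _ F])
    have "restrict_space simplex_borel F = restrict_space borel F"
      using F_sets F_sub simplex_sets by (subst restrict_restrict_space) (auto simp: Int_absorb1)
    then show "info_proj E \<in> borel_measurable (restrict_space simplex_borel F)"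
      using borel_measurable_continuous_on_restrict[OF continuous_on_info_proj[OF E]]
      by (simp add: F)
  qed
qed

section \<open>Closedness and convexity of the constraint set\<close>

lemma convex_prob_simplex: "convex (prob_simplex :: (real ^ 'k::finite) set)"
proof (rule convexI)
  fix p q :: "real ^ 'k" and u v :: real
  assume "p \<in> prob_simplex" "q \<in> prob_simplex" and uv: "0 \<le> u" "0 \<le> v" "u + v = 1"
  then show "u *\<^sub>R p + v *\<^sub>R q \<in> prob_simplex"
    by (simp add: prob_simplex_def sum.distrib sum_distrib_left[symmetric])
qed

text \<open>Inner products exhibit the constraints as hyperplanes and half-spaces, which are closed
  and convex.\<close>

lemma constraint_set_polyhedral:
  "constraint_set g \<alpha> r0 r = prob_simplex \<inter>
     ((\<Inter>j\<in>{1..r0}. {q. (\<chi> x. g j x) \<bullet> q = \<alpha> j}) \<inter> (\<Inter>j\<in>{r0<..r}. {q. (\<chi> x. g j x) \<bullet> q \<ge> \<alpha> j}))"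
  by (auto simp: constraint_set_def mean_def inner_vec_def)

lemma constraint_set_subset_simplex: "constraint_set g \<alpha> r0 r \<subseteq> prob_simplex"
  by (auto simp: constraint_set_def)

lemma closed_constraint_set: "closed (constraint_set g \<alpha> r0 r)"
  unfolding constraint_set_polyhedral
  by (intro closed_Int closed_prob_simplex closed_INT ballI closed_hyperplane closed_halfspace_ge)

lemma convex_constraint_set: "convex (constraint_set g \<alpha> r0 r)"
  unfolding constraint_set_polyhedral
  by (intro convex_Int convex_prob_simplex convex_INT convex_hyperplane convex_halfspace_ge)


section \<open>The predictive formula and its limit for the projected law\<close>

theorem corollary3:
  fixes g :: "nat \<Rightarrow> 'k::finite \<Rightarrow> real" and \<alpha> :: "nat \<Rightarrow> real" and r0 r :: nat
    and \<epsilon> :: "nat \<Rightarrow> real"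
    and E :: "(real ^ 'k) set" and EN :: "nat \<Rightarrow> (nat \<Rightarrow> 'k) set"
    and prior post_lim mixing :: "(real ^ 'k) measure" and post :: "nat \<Rightarrow> (real ^ 'k) measure"
    and QN :: "nat \<Rightarrow> real ^ 'k \<Rightarrow> (nat \<Rightarrow> 'k) measure"
    and PE :: "(nat \<Rightarrow> 'k) measure"
  assumes "r0 \<le> r"
    and E: "E = constraint_set g \<alpha> r0 r" and "E \<noteq> {}"
    and "\<forall>N\<ge>1. \<epsilon> N > 0" and "\<epsilon> \<longlonglongrightarrow> 0"
    and prior_law: "prob_space prior" "sets prior = sets simplex_borel"
    and EN: "EN = (\<lambda>N. {\<omega>. empirical N \<omega> \<in> relaxed_set g \<alpha> r0 r (\<epsilon> N)})"
    and pos: "\<forall>N\<ge>1. (\<integral>\<nu>. measure (iid_law \<nu>) (EN N) \<partial>prior) > 0"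
    and post: "post = (\<lambda>N. constraint_posterior prior (EN N))"
    and QN: "QN = (\<lambda>N \<mu>. uniform_measure (iid_law \<mu>) (EN N))"
    and dom: "\<forall>N\<ge>1. AE \<mu> in post N. \<mu> \<in> info_proj_dom E"
    and limit_law: "prob_space post_lim" "sets post_lim = sets simplex_borel"
    and i: "weakly_converges post post_lim"
    and ii: "\<exists>V. openin (top_of_set prob_simplex) V \<and> msupport post_lim \<subseteq> V \<and> V \<subseteq> info_proj_dom E \<and>
                 continuous_on V (info_proj E)"
    and iii: "\<forall>m. (\<lambda>N. \<integral>\<mu>. tv_dist (prefix_law m (QN N \<mu>)) (product_law m (info_proj E \<mu>)) \<partial>post N)
                   \<longlonglongrightarrow> 0"
    and mixing: "mixing = distr post_lim simplex_borel (info_proj E)"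
    and PE: "PE = mixing \<bind> iid_law"
  shows
    "(\<forall>t h x. measure PE {\<omega>. \<forall>j<t. \<omega> j = h j} > 0 \<longrightarrow>
        cond_prob PE (\<lambda>\<omega>. \<omega> t = x) (\<lambda>\<omega>. \<forall>j<t. \<omega> j = h j) =
          (\<integral>\<mu>. info_proj E \<mu> $ x * (\<Prod>j<t. info_proj E \<mu> $ h j) \<partial>post_lim) /
          (\<integral>\<mu>. (\<Prod>j<t. info_proj E \<mu> $ h j) \<partial>post_lim) \<and>
        cond_prob PE (\<lambda>\<omega>. \<omega> t = x) (\<lambda>\<omega>. \<forall>j<t. \<omega> j = h j) =
          (\<integral>q. q $ x * (\<Prod>j<t. q $ h j) \<partial>mixing) / (\<integral>q. (\<Prod>j<t. q $ h j) \<partial>mixing)) \<and>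
     (\<exists>Qs. directing_measure PE (\<lambda>\<omega>. \<omega>) Qs) \<and>
     (\<forall>(\<Omega> :: 'w measure) X Qs.
        prob_space \<Omega> \<and> directing_measure \<Omega> X Qs \<and> distr \<Omega> path_space X = PE \<longrightarrow>
          distr \<Omega> simplex_borel Qs = mixing \<and>
          (AE w in \<Omega>. (\<lambda>t. predictive PE t (X w)) \<longlonglongrightarrow> Qs w))"
proof -
  have "info_proj E \<in> simplex_borel \<rightarrow>\<^sub>M simplex_borel"
    unfolding E using \<open>E \<noteq> {}\<close>[unfolded E]
    by (intro measurable_info_proj constraint_set_subset_simplex closed_constraint_set convex_constraint_set)
  then have proj [measurable]: "info_proj E \<in> post_lim \<rightarrow>\<^sub>M simplex_borel"
    using measurable_cong_sets[OF limit_law(2) refl] by blast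
  \<comment> \<open>The image of a probability law under a measurable map is a probability law, so
    the results on mixtures apply to \<open>mixing\<close>.\<close>
  interpret simplex_prior mixing
    unfolding mixing simplex_prior_def simplex_prior_axioms_def
    using prob_space.prob_space_distr[OF limit_law(1) proj] by simp
  have PE_mixture: "PE = mixture"
    by (simp add: PE mixture_def)
  \<comment> \<open>Change of variables turns the quotient under \<open>mixing\<close> into the one
    under \<open>post_lim\<close>.\<close>
  have change: "(\<integral>q. f q \<partial>mixing) = (\<integral>\<mu>. f (info_proj E \<mu>) \<partial>post_lim)"
    if "f \<in> borel_measurable simplex_borel" for f :: "real ^ 'k \<Rightarrow> real"
    unfolding mixing by (rule integral_distr[OF proj that])
  have predictive_tendsto: "AE w in \<Omega>. (\<lambda>t. predictive PE t (X w)) \<longlonglongrightarrow> Qs w"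
    and directing_law: "distr \<Omega> simplex_borel Qs = mixing"
    if \<Omega>: "prob_space \<Omega>" and dir: "directing_measure \<Omega> X Qs" and law: "distr \<Omega> path_space X = PE"
    for \<Omega> :: "'w measure" and X Qs
  proof -
    have X [measurable]: "X \<in> \<Omega> \<rightarrow>\<^sub>M path_space" and Qs [measurable]: "Qs \<in> \<Omega> \<rightarrow>\<^sub>M simplex_borel"
      using dir by (simp_all add: directing_measure_def)
    have eq: "AE w in \<Omega>. Qs w = limit_freq (X w)"
      using directing_measure_eq_limit_freq[OF \<Omega> dir] .
    \<comment> \<open>Convergence on path space is pulled back along \<open>X\<close>; the almost
      sure equality \<open>eq\<close> then identifies the limit with \<open>Qs w\<close>.\<close>
    have "AE \<omega> in distr \<Omega> path_space X. (\<lambda>t. predictive PE t \<omega>) \<longlonglongrightarrow> limit_freq \<omega>"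
      unfolding law PE_mixture by (rule AE_predictive_tendsto_limit_freq)
    from AE_distrD[OF X this] eq show "AE w in \<Omega>. (\<lambda>t. predictive PE t (X w)) \<longlonglongrightarrow> Qs w"
      by eventually_elim simp
    have "distr \<Omega> simplex_borel Qs = distr \<Omega> simplex_borel (limit_freq \<circ> X)"
      using eq by (intro distr_cong_AE) (auto simp: comp_def)
    also have "\<dots> = distr (distr \<Omega> path_space X) simplex_borel limit_freq"
      by (rule distr_distr[symmetric]) measurable
    also have "\<dots> = mixing"
      by (simp add: law PE_mixture distr_limit_freq)
    finally show "distr \<Omega> simplex_borel Qs = mixing" .
  qed
  have "cond_prob PE (\<lambda>\<omega>. \<omega> t = x) (\<lambda>\<omega>. \<forall>j<t. \<omega> j = h j) =
      (\<integral>\<mu>. info_proj E \<mu> $ x * (\<Prod>j<t. info_proj E \<mu> $ h j) \<partial>post_lim) /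
      (\<integral>\<mu>. (\<Prod>j<t. info_proj E \<mu> $ h j) \<partial>post_lim)" for t h x
    unfolding PE_mixture cond_prob_mixture
    by (subst (1 2) change) simp_all
  then show ?thesis
    using cond_prob_mixture directing_measure_limit_freq predictive_tendsto directing_law
    by (auto simp: PE_mixture)
qed

end
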